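(* Consider a stochastic click bandit on the item set $[K]$ (with $K$ positions) satisfying Assumptions A1–A5 below, with attraction probabilities $\alpha(1) > \alpha(2) > \dots > \alpha(K) > 0$. Let ${\sf BubbleRank}$ be run for $n$ steps with confidence parameter $\delta \in (0,1)$ and initial base list $\mathcal{R}_0$. Then its expected $n$-step regret satisfies $$R(n) \le 180\, K\, \frac{\chi_{\max}}{\chi_{\min}}\, \frac{K - 1 + 2|\mathcal{V}_0|}{\Delta_{\min}} \log(1/\delta) + \delta^{1/2} K^3 n^2 .$$
   Context: Model. Items are $\mathcal{D} = [K]$; a list $\mathcal{R}$ is an ordering of all $K$ items, $\mathcal{R}(k)$ is the item at position $k$ and $\mathcal{R}^{-1}(i)$ the position of item $i$; $\Pi_K$ denotes the set of such lists. A stochastic click bandit is given by a distribution $P_\alpha$ over attraction vectors in $\{0,1\}^K$ and a distribution $P_\chi$ over examination matrices in $\{0,1\}^{\Pi_K \times [K]}$. At each time $t$, $(\mathbf{A}_t, \mathbf{X}_t)$ is drawn i.i.d. from $P_\alpha \otimes P_\chi$; the learner chooses a list $\mathbf{R}_t$ (depending on the past) and observes clicks $\mathbf{c}_t(k) = \mathbf{X}_t(\mathbf{R}_t, k)\, \mathbf{A}_t(\mathbf{R}_t(k))$ for $k \in [K]$. Let $\alpha = \mathbb{E}[\mathbf{A}_t]$ (attraction probabilities) and $\chi = \mathbb{E}[\mathbf{X}_t]$ ($\chi(\mathcal{R},k)$ is the examination probability of position $k$ in $\mathcal{R}$), and $r(\mathcal{R},\alpha,\chi) = \sum_{k=1}^K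 \chi(\mathcal{R},k)\alpha(\mathcal{R}(k))$. The regret is $R(n) = \sum_{t=1}^n \mathbb{E}[\max_{\mathcal{R} \in \Pi_K} r(\mathcal{R},\alpha,\chi) - r(\mathbf{R}_t,\alpha,\chi)]$. Let $\mathcal{R}^* = (1,\dots,K)$, $\chi_{\max} = \chi(\mathcal{R}^*,1)$, $\chi_{\min} = \chi(\mathcal{R}^*,K)$, $\Delta_{\min} = \min_{k \in [K-1]} (\alpha(k) - \alpha(k+1))$. Assumptions: for all lists $\mathcal{R},\mathcal{R}'$ and positions $k<\ell$: (A1) $r(\mathcal{R},\alpha,\chi) \le r(\mathcal{R}^*,\alpha,\chi)$; (A2) if $\{\mathcal{R}(1),\dots,\mathcal{R}(k-1)\} = \{\mathcal{R}'(1),\dots,\mathcal{R}'(k-1)\}$ then $\chi(\mathcal{R},k) = \chi(\mathcal{R}',k)$; (A3) $\chi(\mathcal{R},k) \ge \chi(\mathcal{R},\ell)$; (A4) if $\mathcal{R}$ and $\mathcal{R}'$ differ only by exchanging the items at positions $k$ and $\ell$, then $\alpha(\mathcal{R}(k)) \le \alpha(\mathcal{R}(\ell)) \iff \chi(\mathcal{R},\ell) \ge \chi(\mathcal{R}',\ell)$; (A5) $\chi(\mathcal{R},k) \ge \chi(\mathcal{R}^*,k)$. Incorrectly-ordered pairs: $\mathcal{V}(\mathcal{R}) = \{(i,j) \in [K]^2 : i<j,\ \mathcal{R}^{-1}(i) > \mathcal{R}^{-1}(j)\}$ and $\mathcal{V}_0 = \mathcal{V}(\mathcal{R}_0)$.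 Algorithm ${\sf BubbleRank}$ (input: initial list $\mathcal{R}_0$, $\delta$, horizon $n$). Set $\mathbf{s}_0(i,j) = \mathbf{n}_0(i,j) = 0$ for all $i,j\in[K]$ and base list $\bar{\mathbf{R}}_1 = \mathcal{R}_0$. For $t = 1,\dots,n$: let $h = t \bmod 2$ and $\mathbf{R}_t \leftarrow \bar{\mathbf{R}}_t$. For each $k = 1,\dots,\lfloor (K-h)/2 \rfloor$, with $i = \mathbf{R}_t(2k-1+h)$, $j = \mathbf{R}_t(2k+h)$: if $\mathbf{s}_{t-1}(i,j) \le 2\sqrt{\mathbf{n}_{t-1}(i,j)\log(1/\delta)}$, exchange the items at positions $2k-1+h$ and $2k+h$ of $\mathbf{R}_t$ with probability $1/2$. Display $\mathbf{R}_t$ and observe $\mathbf{c}_t$. Set $\mathbf{s}_t = \mathbf{s}_{t-1}$, $\mathbf{n}_t = \mathbf{n}_{t-1}$; for each $k = 1,\dots,\lfloor (K-h)/2\rfloor$, with $i = \mathbf{R}_t(2k-1+h)$, $j = \mathbf{R}_t(2k+h)$: if $|\mathbf{c}_t(2k-1+h) - \mathbf{c}_t(2k+h)| = 1$, add $\mathbf{c}_t(2k-1+h) - \mathbf{c}_t(2k+h)$ to $\mathbf{s}_t(i,j)$, add $\mathbf{c}_t(2k+h) - \mathbf{c}_t(2k-1+h)$ to $\mathbf{s}_t(j,i)$, and add $1$ to both $\mathbf{n}_t(i,j)$ and $\mathbf{n}_t(j,i)$. Finally set $\bar{\mathbf{R}}_{t+1} = \bar{\mathbf{R}}_t$ and for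 $k = 1,\dots,K-1$ in order, with $i = \bar{\mathbf{R}}_{t+1}(k)$, $j = \bar{\mathbf{R}}_{t+1}(k+1)$: if $\mathbf{s}_t(j,i) > 2\sqrt{\mathbf{n}_t(j,i)\log(1/\delta)}$, exchange the items at positions $k$ and $k+1$ of $\bar{\mathbf{R}}_{t+1}$. *)

theory Defs
  imports "HOL-Probability.Probability" "HOL-Combinatorics.Permutations"
begin

text \<open>Conventions. Items and positions are the naturals 1..K. A list is a function
  from positions to items that permutes {1..K} (identity outside). An attraction vector
  is a function item => bool, an examination matrix is a function list => position => bool.\<close>

type_synonym rlist = "nat \<Rightarrow> nat"
type_synonym bstate = "(nat \<Rightarrow> nat \<Rightarrow> int) \<times> (nat \<Rightarrow> nat \<Rightarrow> nat) \<times> rlist"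

definition lists_K :: "nat \<Rightarrow> rlist set" where
  "lists_K K = {R. R permutes {1..K}}"

definition attr :: "(nat \<Rightarrow> bool) pmf \<Rightarrow> nat \<Rightarrow> real" where
  "attr PA i = measure_pmf.prob PA {A. A i}"

definition exam :: "(rlist \<Rightarrow> nat \<Rightarrow> bool) pmf \<Rightarrow> rlist \<Rightarrow> nat \<Rightarrow> real" where
  "exam PX R k = measure_pmf.prob PX {X. X R k}"

definition rew :: "nat \<Rightarrow> (nat \<Rightarrow> real) \<Rightarrow> (rlist \<Rightarrow> nat \<Rightarrow> real) \<Rightarrow> rlist \<Rightarrow> real" where
  "rew K alpha chi R = (\<Sum>k=1..K. chi R k * alpha (R k))"

definition swap_pos :: "rlist \<Rightarrow> nat \<Rightarrow> nat \<Rightarrow> rlist" where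
  "swap_pos R p q = R \<circ> Transposition.transpose p q"

definition badpairs :: "nat \<Rightarrow> rlist \<Rightarrow> (nat \<times> nat) set" where
  "badpairs K R = {(i,j). i \<in> {1..K} \<and> j \<in> {1..K} \<and> i < j \<and> inv R i > inv R j}"

definition display :: "nat \<Rightarrow> real \<Rightarrow> nat \<Rightarrow> (nat \<Rightarrow> nat \<Rightarrow> int) \<Rightarrow> (nat \<Rightarrow> nat \<Rightarrow> nat)
    \<Rightarrow> rlist \<Rightarrow> rlist pmf" where
  "display K \<delta> t s m Rb =
     (let h = t mod 2 in
      fold (\<lambda>k P. bind_pmf P (\<lambda>R.
          let p = 2*k - 1 + h; q = 2*k + h; i = R p; j = R q in
          if real_of_int (s i j) \<le> 2 * sqrt (real (m i j) * ln (1/\<delta>))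
          then map_pmf (\<lambda>b. if b then swap_pos R p q else R) (bernoulli_pmf (1/2))
          else return_pmf R))
        [1..<(K - h) div 2 + 1] (return_pmf Rb))"

definition upd_stats :: "nat \<Rightarrow> nat \<Rightarrow> rlist \<Rightarrow> (nat \<Rightarrow> bool)
    \<Rightarrow> (nat \<Rightarrow> nat \<Rightarrow> int) \<times> (nat \<Rightarrow> nat \<Rightarrow> nat) \<Rightarrow> (nat \<Rightarrow> nat \<Rightarrow> int) \<times> (nat \<Rightarrow> nat \<Rightarrow> nat)" where
  "upd_stats K t R c sm =
     (let h = t mod 2 in
      fold (\<lambda>k (s, m).
          let p = 2*k - 1 + h; q = 2*k + h; i = R p; j = R q in
          if c p \<noteq> c q then
            (s(i := (s i)(j := s i j + (of_bool (c p) - of_bool (c q))),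
               j := (s j)(i := s j i + (of_bool (c q) - of_bool (c p)))),
             m(i := (m i)(j := m i j + 1), j := (m j)(i := m j i + 1)))
          else (s, m))
        [1..<(K - h) div 2 + 1] sm)"

definition upd_base :: "nat \<Rightarrow> real \<Rightarrow> (nat \<Rightarrow> nat \<Rightarrow> int) \<Rightarrow> (nat \<Rightarrow> nat \<Rightarrow> nat) \<Rightarrow> rlist \<Rightarrow> rlist" where
  "upd_base K \<delta> s m Rb =
     fold (\<lambda>k R. let i = R k; j = R (k+1) in
                 if real_of_int (s j i) > 2 * sqrt (real (m j i) * ln (1/\<delta>))
                 then swap_pos R k (k+1) else R)
          [1..<K] Rb"

text \<open>One round t of BubbleRank starting from state (s_{t-1}, n_{t-1}, base list of round t).\<close>
definition bubble_step :: "(nat \<Rightarrow> bool) pmf \<Rightarrow> (rlist \<Rightarrow> nat \<Rightarrow> bool) pmf \<Rightarrow> nat \<Rightarrow> real \<Rightarrow> nat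
    \<Rightarrow> bstate \<Rightarrow> bstate pmf" where
  "bubble_step PA PX K \<delta> t st =
     (case st of (s, m, Rb) \<Rightarrow>
       bind_pmf (display K \<delta> t s m Rb) (\<lambda>R.
       bind_pmf PA (\<lambda>A.
       bind_pmf PX (\<lambda>X.
         let c = (\<lambda>k. X R k \<and> A (R k));
             sm' = upd_stats K t R c (s, m)
         in return_pmf (fst sm', snd sm', upd_base K \<delta> (fst sm') (snd sm') Rb)))))"

fun bubble_state :: "(nat \<Rightarrow> bool) pmf \<Rightarrow> (rlist \<Rightarrow> nat \<Rightarrow> bool) pmf \<Rightarrow> nat \<Rightarrow> real \<Rightarrow> rlist
    \<Rightarrow> nat \<Rightarrow> bstate pmf" where
  "bubble_state PA PX K \<delta> R0 0 = return_pmf (\<lambda>_ _. 0, \<lambda>_ _. 0, R0)"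
| "bubble_state PA PX K \<delta> R0 (Suc t) =
     bind_pmf (bubble_state PA PX K \<delta> R0 t) (bubble_step PA PX K \<delta> (Suc t))"

definition displayed :: "(nat \<Rightarrow> bool) pmf \<Rightarrow> (rlist \<Rightarrow> nat \<Rightarrow> bool) pmf \<Rightarrow> nat \<Rightarrow> real \<Rightarrow> rlist
    \<Rightarrow> nat \<Rightarrow> rlist pmf" where
  "displayed PA PX K \<delta> R0 t =
     bind_pmf (bubble_state PA PX K \<delta> R0 (t - 1)) (\<lambda>(s, m, Rb). display K \<delta> t s m Rb)"

definition regret :: "(nat \<Rightarrow> bool) pmf \<Rightarrow> (rlist \<Rightarrow> nat \<Rightarrow> bool) pmf \<Rightarrow> nat \<Rightarrow> real \<Rightarrow> rlist
    \<Rightarrow> nat \<Rightarrow> real" where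
  "regret PA PX K \<delta> R0 n =
     (\<Sum>t=1..n. measure_pmf.expectation (displayed PA PX K \<delta> R0 t)
        (\<lambda>R. Max ((rew K (attr PA) (exam PX)) ` lists_K K) - rew K (attr PA) (exam PX) R))"

end

theory Submission
  imports Defs
begin

text \<open>
  For \<open>i < j\<close> the statistic \<open>s i j\<close> is a walk with steps in \<open>{-1, 0, 1}\<close>. Whenever \<open>i\<close> and \<open>j\<close> are
  compared, its expected step \<open>\<mu>\<close> and its probability \<open>\<rho>\<close> of moving satisfy
  \<open>\<mu> \<ge> \<chi>\<^sub>m\<^sub>i\<^sub>n (\<alpha> i - \<alpha> j)\<close> and \<open>\<mu> \<ge> \<gamma> \<rho>\<close> with \<open>\<gamma> = (\<alpha> i - \<alpha> j) / (\<alpha> i + \<alpha> j)\<close>: if the exchange is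
  randomised, this follows by averaging over the exchange with A2 and A4, otherwise from A3.

  The regret of a round is at most \<open>K \<chi>\<^sub>m\<^sub>a\<^sub>x\<close> times the sum of the attraction gaps of the pairs randomised
  in this round and of the inverted adjacent pairs of the other parity, which are randomised in
  the next round unless an exchange in the base list separates them. Hence a potential pays for all
  rounds. It consists of a function of \<open>s i j\<close> and of the number of comparisons for every pair
  that is adjacent in the base list or has been compared before, and of a multiple of the number of inversions of the base list. As long
  as no wrong order is ever believed with confidence, every exchange in the base list removes an
  inversion, creates at most two new adjacent pairs and leaves behind at most one adjacent pair that
  is known to be in the wrong order.

  Wrong beliefs are controlled by the exponential supermartingales
  \<open>exp (- \<lambda> s i j - \<lambda>\<^sup>2 m i j)\<close> with \<open>\<lambda> = sqrt (ln (1/\<delta>) / k)\<close>, one for each possible number \<open>k\<close> of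
  comparisons. Both parts are combined by induction on the number of remaining rounds. For
  \<open>\<delta> \<ge> 1/16\<close> the second term of the bound exceeds the trivial bound \<open>K n\<close>.
\<close>

section \<open>Exponential inequalities for steps in {-1, 0, 1}\<close>

lemma exp_le_quadratic:
  fixes y :: real
  assumes "y \<le> 1"
  shows "exp y \<le> 1 + y + y\<^sup>2"
proof (cases "y \<ge> 0")
  case True
  then show ?thesis using assms by (intro exp_bound) auto
next
  case False
  \<comment> \<open>It suffices that \<open>(1 - z + z^2) * exp z >= 1\<close>, which follows by
    expanding the product with the second-order Taylor lower bound of \<open>exp z\<close>.\<close>
  define z where "z = - y"
  have z: "z > 0" using False by (simp add: z_def)
  have "1 + z + z\<^sup>2 / 2 \<le> exp z" using exp_lower_Taylor_quadratic[of z] z by simp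
  moreover have "1 \<le> (1 - z + z\<^sup>2) * (1 + z + z\<^sup>2 / 2)"
  proof -
    have "(1 - z + z\<^sup>2) * (1 + z + z\<^sup>2 / 2) = 1 + (z^2 + z^3 + z^4) / 2"
      by (simp add: field_simps power2_eq_square power3_eq_cube power4_eq_xxxx)
    then show ?thesis using z by simp
  qed
  moreover have "1 - z + z\<^sup>2 \<ge> 0"
    using zero_le_power2[of "z - 1/2"] by (simp add: power2_diff) (simp add: power2_eq_square)
  ultimately have "1 \<le> (1 - z + z\<^sup>2) * exp z"
    by (meson mult_left_mono order_trans)
  then have "exp (- z) \<le> 1 - z + z\<^sup>2"
    by (simp add: exp_minus field_simps)
  then show ?thesis by (simp add: z_def)
qed

lemma cosh_le_exp_square: "cosh (x::real) \<le> exp (x\<^sup>2)"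
proof (cases "\<bar>x\<bar> \<le> 1")
  case True
  have "exp x \<le> 1 + x + x\<^sup>2" "exp (- x) \<le> 1 + (- x) + (- x)\<^sup>2"
    using True by (intro exp_le_quadratic; simp)+
  then have "cosh x \<le> 1 + x\<^sup>2" by (simp add: cosh_def)
  then show ?thesis using exp_ge_add_one_self[of "x\<^sup>2"] by linarith
next
  case False
  have "cosh x = cosh \<bar>x\<bar>" by simp
  also have "\<dots> \<le> exp \<bar>x\<bar>" using False unfolding cosh_def by (simp add: abs_if)
  also have "\<dots> \<le> exp (x\<^sup>2)"
  proof -
    have "1 * \<bar>x\<bar> \<le> \<bar>x\<bar> * \<bar>x\<bar>" using False by (intro mult_right_mono) auto
    then show ?thesis by (simp add: power2_eq_square)
  qed
  finally show ?thesis .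
qed

text \<open>At \<open>x = 1\<close> and \<open>x = -1\<close> the left side is
  \<open>(cosh l - x * sinh l) * exp (- l^2)\<close>, and \<open>cosh l * exp (- l^2) <= 1\<close>.
  The bound is affine in \<open>x\<close>, so after taking expectations only the sign of the mean
  step matters, not the probability of moving.\<close>

lemma exp_walk_step:
  fixes x :: int and l :: real
  assumes "x \<in> {-1, 0, 1}"
  shows "exp (- l * x - l\<^sup>2 * \<bar>x\<bar>) \<le> 1 - x * (sinh l * exp (- l\<^sup>2))"
proof -
  have c: "cosh l * exp (- l\<^sup>2) \<le> 1"
    using cosh_le_exp_square[of l] by (simp add: exp_minus field_simps)
  have "exp (- l) = cosh l - sinh l" "exp l = cosh l + sinh l"
    by (simp_all add: cosh_minus_sinh cosh_plus_sinh)
  then have "exp (- l - l\<^sup>2) = (cosh l - sinh l) * exp (- l\<^sup>2)"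
    "exp (l - l\<^sup>2) = (cosh l + sinh l) * exp (- l\<^sup>2)"
    by (metis exp_add diff_conv_add_uminus)+
  with c assms show ?thesis by (auto simp: algebra_simps)
qed

section \<open>Potential of a single pair\<close>

text \<open>Slope \<open>-1\<close> up to \<open>U\<close>, continued by an exponential tail so that the function stays nonnegative and
  remains a supermartingale beyond \<open>U\<close>.\<close>

definition lin_exp :: "real \<Rightarrow> int \<Rightarrow> int \<Rightarrow> real" where
  "lin_exp g U a = (if a \<le> U then real_of_int (U - a) + 2 / g
                    else 2 / g * exp (- (g / 2) * real_of_int (a - U)))"

text \<open>An unsure walk beyond \<open>U = 8 L / g\<close> must satisfy \<open>2 a \<le> g b\<close>; these rounds are paid by the
  second summand, all other unsure rounds by the first.\<close>

definition pair_pot :: "real \<Rightarrow> real \<Rightarrow> int \<Rightarrow> nat \<Rightarrow> real" where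
  "pair_pot g L a b = 2 * lin_exp g \<lceil>8 * L / g\<rceil> a
     + 36 / g * exp (- (g / 9) * (real_of_int a - g / 2 * real b))"

lemma lin_exp_nonneg: "g > 0 \<Longrightarrow> lin_exp g U a \<ge> 0"
  by (auto simp: lin_exp_def)

lemma pair_pot_nonneg: "g > 0 \<Longrightarrow> pair_pot g L a b \<ge> 0"
  by (simp add: pair_pot_def lin_exp_nonneg)

lemma pair_pot_zero_le:
  assumes "0 < g" "g \<le> 1" "L > 0"
  shows "pair_pot g L 0 0 \<le> (16 * L + 42) / g"
proof -
  define u where "u = real_of_int \<lceil>8 * L / g\<rceil>"
  have "0 \<le> \<lceil>8 * L / g\<rceil>"
    using assms by (metis ceiling_zero ceiling_mono divide_nonneg_pos less_imp_le mult_nonneg_nonneg zero_le_numeral)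
  then have "pair_pot g L 0 0 = 2 * (u + 2 / g) + 36 / g"
    by (simp add: pair_pot_def lin_exp_def u_def)
  \<comment> \<open>Rounding up costs at most 1, which is at most \<open>1 / g\<close>; the constant
    42 is \<open>2 * (1 + 2) + 36\<close>.\<close>
  moreover have "u \<le> 8 * L / g + 1" unfolding u_def by linarith
  moreover have "1 \<le> 1 / g" using assms by simp
  ultimately have "u \<le> 8 * L / g + 1 / g" and pp: "pair_pot g L 0 0 = 2 * (u + 2 / g) + 36 / g" by linarith+
  then have "pair_pot g L 0 0 \<le> 2 * (8 * L / g + 1 / g + 2 / g) + 36 / g" unfolding pp by simp
  also have "\<dots> = (16 * L + 42) / g" by (simp add: add_divide_distrib)
  finally show ?thesis .
qed

text \<open>The linear branch is the tangent at \<open>U\<close> of the exponential branch, and a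
  convex function lies above its tangents.\<close>

lemma lin_exp_le_exp:
  assumes "g > 0"
  shows "lin_exp g U a \<le> 2 / g * exp (- (g / 2) * real_of_int (a - U))"
proof (cases "a \<le> U")
  case True
  have "1 + (g / 2) * (U - a) \<le> exp ((g / 2) * real_of_int (U - a))"
    using exp_ge_add_one_self by auto
  then have "2 / g * (1 + (g / 2) * (U - a)) \<le> 2 / g * exp ((g / 2) * real_of_int (U - a))"
    using assms by (intro mult_left_mono) auto
  moreover have "2 / g * (1 + (g / 2) * (U - a)) = lin_exp g U a"
    using True assms by (simp add: lin_exp_def field_simps)
  moreover have "(g / 2) * real_of_int (U - a) = - (g / 2) * real_of_int (a - U)"
    by (simp add: algebra_simps diff_divide_distrib)
  ultimately show ?thesis by metis
qed (simp add: lin_exp_def)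

lemma lin_exp_step:
  assumes g: "0 < g" "g \<le> 1"
  obtains c1 c2 where "c1 \<ge> 0" "c2 \<ge> 0" "a \<le> U \<Longrightarrow> c2 \<ge> 1 / 2"
    "\<And>x. x \<in> {-1, 0, 1} \<Longrightarrow>
       lin_exp g U (a + x) \<le> lin_exp g U a + c1 * (g * \<bar>x\<bar> - x) - c2 * real_of_int x"
proof (cases "a < U")
  case True
  show ?thesis
    by (rule that[of 0 1]) (use True in \<open>auto simp: lin_exp_def\<close>)
next
  case False
  define e where "e = exp (- (g / 2) * real_of_int (a - U))"
  have eq: "lin_exp g U a = 2 / g * e"
    using False by (auto simp: lin_exp_def e_def)
  have e: "e > 0" by (simp add: e_def)
  \<comment> \<open>The exponential branch yields the drift \<open>- e * x\<close> and the quadratic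
    error \<open>e / 2 * g * |x|\<close>. One half of the drift is grouped with the error as the
    \<open>c1\<close> term, the other half is the gain.\<close>
  show ?thesis
  proof (rule that[of "e / 2" "e / 2"])
    show "e / 2 \<ge> 1 / 2" if "a \<le> U" using that False by (simp add: e_def)
    fix x :: int assume x: "x \<in> {-1, 0, 1}"
    have "lin_exp g U (a + x) \<le> 2 / g * exp (- (g / 2) * real_of_int (a + x - U))"
      by (rule lin_exp_le_exp[OF g(1)])
    also have "exp (- (g / 2) * real_of_int (a + x - U)) = e * exp (- (g / 2) * x)"
      unfolding e_def by (simp add: algebra_simps flip: exp_add) (simp add: field_simps)
    also have "2 / g * (e * exp (- (g / 2) * x)) \<le>
        2 / g * (e * (1 + (- (g / 2) * x) + (- (g / 2) * x)\<^sup>2))"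
      using g e x by (intro mult_left_mono exp_le_quadratic) auto
    also have "\<dots> = 2 / g * e - e * x + (e / 2) * g * x\<^sup>2"
      using g by (simp add: field_simps power2_eq_square)
    also have "\<dots> = 2 / g * e - e * x + (e / 2) * g * \<bar>x\<bar>" using x by auto
    finally show "lin_exp g U (a + x) \<le> lin_exp g U a + e / 2 * (g * \<bar>x\<bar> - x) - e / 2 * x"
      by (simp add: eq algebra_simps)
  qed (use e in auto)
qed

text \<open>Up to \<open>U\<close> the gain coefficient is at least 1 because \<open>lin_exp\<close>
  is taken twice; beyond \<open>U\<close> an unsure walk has a nonnegative exponent in the second
  summand of \<open>pair_pot\<close>, whose own gain coefficient \<open>Z\<close> is then at least
  1.\<close>

lemma pair_pot_step:
  assumes g: "0 < g" "g \<le> 1" and L: "L > 0"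
  obtains c1 c2 where "c1 \<ge> 0" "c2 \<ge> 0"
    "real_of_int a \<le> 2 * sqrt (real b * L) \<Longrightarrow> c2 \<ge> 1"
    "\<And>x. x \<in> {-1, 0, 1} \<Longrightarrow>
       pair_pot g L (a + x) (b + nat \<bar>x\<bar>)
         \<le> pair_pot g L a b + c1 * (g * \<bar>x\<bar> - x) - c2 * real_of_int x"
proof -
  define U where "U = \<lceil>8 * L / g\<rceil>"
  obtain d1 d2 where d: "d1 \<ge> 0" "d2 \<ge> 0" "a \<le> U \<Longrightarrow> d2 \<ge> 1 / 2"
    "\<And>x. x \<in> {-1, 0, 1} \<Longrightarrow>
       lin_exp g U (a + x) \<le> lin_exp g U a + d1 * (g * \<bar>x\<bar> - x) - d2 * real_of_int x"
    using lin_exp_step[OF g] by blast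
  define Z where "Z = exp (- (g / 9) * (real_of_int a - g / 2 * real b))"
  have Z: "Z > 0" by (simp add: Z_def)
  show ?thesis
  proof (rule that[of "2 * d1 + 3 * Z" "2 * d2 + Z"])
    assume un: "real_of_int a \<le> 2 * sqrt (real b * L)"
    show "2 * d2 + Z \<ge> 1"
    proof (cases "a \<le> U")
      case True
      then show ?thesis using d(3) Z by linarith
    next
      case False
      then have a: "a > 8 * L / g" unfolding U_def by linarith
      have a0: "a > 0" using a L g by (smt (verit) divide_pos_pos of_int_0_less_iff mult_pos_pos)
      \<comment> \<open>The squared threshold gives \<open>a^2 <= 4 * b * L\<close>; cancelling one
        factor \<open>a\<close> against \<open>a > 8 * L / g\<close> leaves
        \<open>2 * a <= g * b\<close>.\<close>
      have "(real_of_int a)\<^sup>2 \<le> (2 * sqrt (real b * L))\<^sup>2"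
        using un a0 by (intro power_mono) auto
      then have "a * real_of_int a \<le> 4 * b * L" using L by (simp add: power_mult_distrib power2_eq_square)
      moreover have "(8 * L / g) * a \<le> a * real_of_int a" using a a0 by (intro mult_right_mono) auto
      ultimately have "(8 * L / g) * a \<le> 4 * b * L" by linarith
      then have "(8 * L / g) * a * (g / 4) \<le> 4 * b * L * (g / 4)"
        using g by (intro mult_right_mono) auto
      then have "L * (2 * a) \<le> L * (g * b)" using g by (simp add: mult_ac)
      then have "2 * a \<le> g * b" using L by simp
      then have "Z \<ge> 1" unfolding Z_def using g by (simp add: mult_le_0_iff)
      then show ?thesis using d(2) by linarith
    qed
  next
    fix x :: int assume x: "x \<in> {-1, 0, 1}"
    define y where "y = (g / 9) * (g / 2 * \<bar>x\<bar> - x)"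
    have xsq: "(g / 2 * real_of_int \<bar>x\<bar> - x)\<^sup>2 \<le> 9 / 4 * \<bar>x\<bar>"
    proof -
      have "\<bar>g / 2 * real_of_int \<bar>x\<bar> - x\<bar> \<le> 3 / 2 * \<bar>x\<bar>" using x g by auto
      then have "\<bar>g / 2 * real_of_int \<bar>x\<bar> - x\<bar>\<^sup>2 \<le> (3 / 2 * real_of_int \<bar>x\<bar>)\<^sup>2"
        by (intro power_mono) auto
      moreover have "(3 / 2 * real_of_int \<bar>x\<bar>)\<^sup>2 = 9 / 4 * \<bar>x\<bar>"
        using x by (auto simp: power2_eq_square)
      ultimately show ?thesis by simp
    qed
    have y1: "y \<le> 1"
    proof -
      have "g / 2 * real_of_int \<bar>x\<bar> - x \<le> 2" using x g by auto
      then have "y \<le> (g / 9) * 2" unfolding y_def using g by (intro mult_left_mono) auto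
      then show ?thesis using g by linarith
    qed
    have "exp (- (g / 9) * (real_of_int (a + x) - g / 2 * real (b + nat \<bar>x\<bar>))) = Z * exp y"
      unfolding Z_def y_def by (simp add: algebra_simps flip: exp_add)
    also have "\<dots> \<le> Z * (1 + y + y\<^sup>2)"
      using Z exp_le_quadratic[OF y1] by simp
    also have "\<dots> \<le> Z * (1 + y + (g / 9)\<^sup>2 * (9 / 4 * \<bar>x\<bar>))"
      using Z xsq unfolding y_def power_mult_distrib[of "g/9"]
      by (intro mult_left_mono add_left_mono) auto
    finally have "36 / g * exp (- (g / 9) * (real_of_int (a + x) - g / 2 * real (b + nat \<bar>x\<bar>)))
        \<le> 36 / g * (Z * (1 + y + (g / 9)\<^sup>2 * (9 / 4 * \<bar>x\<bar>)))"
      using g by (intro mult_left_mono) auto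
    \<comment> \<open>The linear part of the expansion contributes
      \<open>Z * (2 * g * |x| - 4 * x)\<close> and the quadratic part \<open>Z * g * |x|\<close>.
      The constants 9 and 36 are chosen such that one full \<open>Z * x\<close> is left over after
      splitting off three copies of \<open>g * |x| - x\<close>.\<close>
    also have "\<dots> = 36 / g * Z + 3 * Z * (g * \<bar>x\<bar> - x) - Z * x"
      using g unfolding y_def by (simp add: field_simps power2_eq_square)
    finally have z: "36 / g * exp (- (g / 9) * (real_of_int (a + x) - g / 2 * real (b + nat \<bar>x\<bar>)))
        \<le> 36 / g * Z + 3 * Z * (g * \<bar>x\<bar> - x) - Z * x" .
    show "pair_pot g L (a + x) (b + nat \<bar>x\<bar>)
         \<le> pair_pot g L a b + (2 * d1 + 3 * Z) * (g * \<bar>x\<bar> - x) - (2 * d2 + Z) * x"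
      using z d(4)[OF x] unfolding pair_pot_def U_def[symmetric] Z_def[symmetric]
      by (simp add: algebra_simps)
  qed (use d Z in auto)
qed

section \<open>Rounds of the algorithm\<close>

definition thr :: "real \<Rightarrow> nat \<Rightarrow> real" where
  "thr \<delta> b = 2 * sqrt (real b * ln (1 / \<delta>))"

definition unsure :: "real \<Rightarrow> (nat \<Rightarrow> nat \<Rightarrow> int) \<Rightarrow> (nat \<Rightarrow> nat \<Rightarrow> nat) \<Rightarrow> nat \<Rightarrow> rlist \<Rightarrow> bool" where
  "unsure \<delta> s m p R \<longleftrightarrow> real_of_int (s (R p) (R (Suc p))) \<le> thr \<delta> (m (R p) (R (Suc p)))"

definition flip :: "real \<Rightarrow> (nat \<Rightarrow> nat \<Rightarrow> int) \<Rightarrow> (nat \<Rightarrow> nat \<Rightarrow> nat) \<Rightarrow> nat \<Rightarrow> rlist \<Rightarrow> rlist pmf" where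
  "flip \<delta> s m p R =
     (if unsure \<delta> s m p R
      then map_pmf (\<lambda>b. if b then swap_pos R p (Suc p) else R) (bernoulli_pmf (1/2))
      else return_pmf R)"

text \<open>The left positions \<open>2 * k - 1 + h\<close> of the pairs compared in round
  \<open>t\<close>, characterised by parity. Hence two compared pairs never share a position, and
  two consecutive rounds together cover all neighbours.\<close>

definition acts :: "nat \<Rightarrow> nat \<Rightarrow> nat set" where
  "acts K t = {p. 1 \<le> p \<and> p < K \<and> odd (p + t)}"

definition acts_list :: "nat \<Rightarrow> nat \<Rightarrow> nat list" where
  "acts_list K t = map (\<lambda>k. 2 * k - 1 + t mod 2) [1..<(K - t mod 2) div 2 + 1]"

lemma finite_acts [simp]: "finite (acts K t)"
  by (rule finite_subset[of _ "{..<K}"]) (auto simp: acts_def)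

lemma acts_Suc_notin: "p \<in> acts K t \<Longrightarrow> Suc p \<notin> acts K t"
  by (auto simp: acts_def)

lemma set_acts_list: "set (acts_list K t) = acts K t"
proof
  show "set (acts_list K t) \<subseteq> acts K t"
    by (auto simp: acts_list_def acts_def)
  show "acts K t \<subseteq> set (acts_list K t)"
  proof
    fix p assume p: "p \<in> acts K t"
    define k where "k = (p + 1 - t mod 2) div 2"
    have "p = 2 * k - 1 + t mod 2" "1 \<le> k" "k < (K - t mod 2) div 2 + 1"
      using p unfolding acts_def k_def by (auto, presburger+)
    then show "p \<in> set (acts_list K t)" unfolding acts_list_def set_map by (intro image_eqI[of _ _ k]) auto
  qed
qed

lemma distinct_acts_list: "distinct (acts_list K t)"
  unfolding acts_list_def by (auto simp: distinct_map inj_on_def)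

lemma display_eq_fold:
  "display K \<delta> t s m Rb = fold (\<lambda>p P. bind_pmf P (flip \<delta> s m p)) (acts_list K t) (return_pmf Rb)"
proof -
  \<comment> \<open>The subtraction in \<open>2 * k - 1\<close> is truncated; the right position is
    the successor of the left one because the loop starts at \<open>k = 1\<close>.\<close>
  have *: "2 * k + t mod 2 = Suc (2 * k - 1 + t mod 2)" if "k \<in> set [1..<(K - t mod 2) div 2 + 1]" for k
    using that by auto
  show ?thesis
    unfolding display_def acts_list_def fold_map Let_def
  proof (rule fold_cong[OF refl refl])
    fix k assume k: "k \<in> set [1..<(K - t mod 2) div 2 + 1]"
    show "(\<lambda>P. bind_pmf P (\<lambda>R.
          if real_of_int (s (R (2 * k - 1 + t mod 2)) (R (2 * k + t mod 2)))
             \<le> 2 * sqrt (real (m (R (2 * k - 1 + t mod 2)) (R (2 * k + t mod 2))) * ln (1 / \<delta>))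
          then map_pmf (\<lambda>b. if b then swap_pos R (2 * k - 1 + t mod 2) (2 * k + t mod 2) else R)
                 (bernoulli_pmf (1 / 2))
          else return_pmf R))
        = ((\<lambda>p P. bind_pmf P (flip \<delta> s m p)) \<circ> (\<lambda>k. 2 * k - 1 + t mod 2)) k"
      unfolding *[OF k] flip_def[abs_def] unsure_def thr_def comp_def ..
  qed
qed

section \<open>Exchanges of positions and the law of the displayed list\<close>

lemma swap_pos_apply:
  "swap_pos R p q p = R q" "swap_pos R p q q = R p"
  "l \<noteq> p \<Longrightarrow> l \<noteq> q \<Longrightarrow> swap_pos R p q l = R l"
  by (auto simp: swap_pos_def)

lemma swap_pos_swap_pos [simp]: "swap_pos (swap_pos R p q) p q = R"
  by (simp add: swap_pos_def fun_eq_iff)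

lemma swap_pos_commute:
  assumes "{p, q} \<inter> {p', q'} = {}"
  shows "swap_pos (swap_pos R p q) p' q' = swap_pos (swap_pos R p' q') p q"
proof
  fix l
  show "swap_pos (swap_pos R p q) p' q' l = swap_pos (swap_pos R p' q') p q l"
    using assms by (cases "l \<in> {p, q}"; cases "l \<in> {p', q'}") (auto simp: swap_pos_apply)
qed

lemma swap_pos_lists_K:
  assumes "R \<in> lists_K K" "p \<in> {1..K}" "q \<in> {1..K}"
  shows "swap_pos R p q \<in> lists_K K"
  using assms unfolding lists_K_def swap_pos_def
  by (auto intro!: permutes_compose permutes_swap_id)

lemma map_Not_bernoulli_half: "map_pmf Not (bernoulli_pmf (1/2)) = bernoulli_pmf (1/2)"
proof (rule pmf_eqI)
  fix b :: bool
  have "pmf (map_pmf Not (bernoulli_pmf (1/2))) (\<not> (\<not> b)) = pmf (bernoulli_pmf (1/2)) (\<not> b)"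
    by (rule pmf_map_inj') (auto simp: inj_def)
  then show "pmf (map_pmf Not (bernoulli_pmf (1/2))) b = pmf (bernoulli_pmf (1/2)) b"
    by (cases b) auto
qed

text \<open>A further exchange negates the coin, and a fair coin is symmetric.\<close>

lemma map_swap_flip_same:
  assumes "unsure \<delta> s m p R"
  shows "map_pmf (\<lambda>R. swap_pos R p (Suc p)) (flip \<delta> s m p R) = flip \<delta> s m p R"
proof -
  have "map_pmf (\<lambda>R. swap_pos R p (Suc p)) (flip \<delta> s m p R)
      = map_pmf (\<lambda>b. if b then swap_pos R p (Suc p) else R) (map_pmf Not (bernoulli_pmf (1/2)))"
    using assms by (auto simp: flip_def map_pmf_comp intro!: map_pmf_cong)
  then show ?thesis using assms by (simp add: map_Not_bernoulli_half flip_def)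
qed

lemma map_swap_flip_other:
  assumes "{p, Suc p} \<inter> {p', Suc p'} = {}"
  shows "map_pmf (\<lambda>R. swap_pos R p (Suc p)) (flip \<delta> s m p' R) = flip \<delta> s m p' (swap_pos R p (Suc p))"
  using assms swap_pos_commute[OF assms]
  by (auto simp: flip_def unsure_def map_pmf_comp swap_pos_apply intro!: map_pmf_cong)

text \<open>The pairs are disjoint, so when a pair is processed its two positions still hold the
  items of the base list. The test for randomisation can therefore be read off from
  \<open>Rb\<close>.\<close>

lemma fold_flip_support:
  assumes "R \<in> set_pmf (fold (\<lambda>p P. bind_pmf P (flip \<delta> s m p)) ps (return_pmf Rb))"
    and "distinct ps" "\<forall>p\<in>set ps. Suc p \<notin> set ps"
  shows "(\<forall>p\<in>set ps. R p = Rb p \<and> R (Suc p) = Rb (Suc p) \<or>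
           unsure \<delta> s m p Rb \<and> R p = Rb (Suc p) \<and> R (Suc p) = Rb p) \<and>
         (\<forall>l. (\<forall>p\<in>set ps. l \<noteq> p \<and> l \<noteq> Suc p) \<longrightarrow> R l = Rb l)"
  using assms
proof (induction ps arbitrary: R rule: rev_induct)
  case (snoc p ps)
  then obtain R1 where R1: "R1 \<in> set_pmf (fold (\<lambda>p P. bind_pmf P (flip \<delta> s m p)) ps (return_pmf Rb))"
    and R: "R \<in> set_pmf (flip \<delta> s m p R1)" by auto
  have sep: "p \<notin> set ps" "\<forall>p'\<in>set ps. p \<noteq> Suc p' \<and> Suc p \<noteq> p'" using snoc.prems by auto
  have IH: "(\<forall>p\<in>set ps. R1 p = Rb p \<and> R1 (Suc p) = Rb (Suc p) \<or>
           unsure \<delta> s m p Rb \<and> R1 p = Rb (Suc p) \<and> R1 (Suc p) = Rb p)"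
    "\<And>l. (\<forall>p\<in>set ps. l \<noteq> p \<and> l \<noteq> Suc p) \<Longrightarrow> R1 l = Rb l"
    using snoc.IH[OF R1] snoc.prems by auto
  have eq: "R1 p = Rb p" "R1 (Suc p) = Rb (Suc p)"
    using sep by (auto intro!: IH(2))
  have "R = R1 \<or> unsure \<delta> s m p Rb \<and> R = swap_pos R1 p (Suc p)"
    using R eq by (auto simp: flip_def unsure_def split: if_splits)
  then show ?case
  proof
    assume "R = R1"
    then show ?thesis using IH eq by auto
  next
    assume R: "unsure \<delta> s m p Rb \<and> R = swap_pos R1 p (Suc p)"
    have "R p' = R1 p' \<and> R (Suc p') = R1 (Suc p')" if "p' \<in> set ps" for p'
      using that sep R by (metis nat.inject swap_pos_apply(3))
    then show ?thesis using IH eq R by (auto simp: swap_pos_apply)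
  qed
qed auto

lemma display_support:
  assumes "R \<in> set_pmf (display K \<delta> t s m Rb)"
  shows "p \<in> acts K t \<Longrightarrow> R p = Rb p \<and> R (Suc p) = Rb (Suc p) \<or>
           unsure \<delta> s m p Rb \<and> R p = Rb (Suc p) \<and> R (Suc p) = Rb p"
    and "(\<And>p. p \<in> acts K t \<Longrightarrow> l \<noteq> p \<and> l \<noteq> Suc p) \<Longrightarrow> R l = Rb l"
  using fold_flip_support[OF assms[unfolded display_eq_fold] distinct_acts_list]
  by (auto simp: set_acts_list acts_Suc_notin)

lemma fold_flip_lists_K:
  assumes "Rb \<in> lists_K K" "set ps \<subseteq> {1..<K}"
    "R \<in> set_pmf (fold (\<lambda>p P. bind_pmf P (flip \<delta> s m p)) ps (return_pmf Rb))"
  shows "R \<in> lists_K K"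
  using assms(2,3)
  by (induction ps arbitrary: R rule: rev_induct)
     (use assms(1) in \<open>auto simp: flip_def split: if_splits intro!: swap_pos_lists_K\<close>)

lemma display_lists_K:
  assumes "Rb \<in> lists_K K" "R \<in> set_pmf (display K \<delta> t s m Rb)"
  shows "R \<in> lists_K K"
  using assms(2) unfolding display_eq_fold
  by (intro fold_flip_lists_K[OF assms(1)]) (auto simp: set_acts_list acts_def)

text \<open>The exchange commutes with the coins of the other, disjoint pairs and is absorbed by the
  coin of its own pair. This symmetry later permits averaging over both orders of a randomised
  pair.\<close>

lemma fold_flip_swap_invariant:
  assumes "p \<in> set ps" "unsure \<delta> s m p Rb" "distinct ps" "\<forall>p\<in>set ps. Suc p \<notin> set ps"
  shows "map_pmf (\<lambda>R. swap_pos R p (Suc p)) (fold (\<lambda>p P. bind_pmf P (flip \<delta> s m p)) ps (return_pmf Rb))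
       = fold (\<lambda>p P. bind_pmf P (flip \<delta> s m p)) ps (return_pmf Rb)"
  using assms
proof (induction ps rule: rev_induct)
  case (snoc p' ps)
  let ?D = "fold (\<lambda>p P. bind_pmf P (flip \<delta> s m p)) ps (return_pmf Rb)"
  let ?sw = "\<lambda>R. swap_pos R p (Suc p)"
  show ?case
  proof (cases "p' = p")
    case True
    have "unsure \<delta> s m p R" if "R \<in> set_pmf ?D" for R
    proof -
      have "R l = Rb l" if "l \<in> {p, Suc p}" for l
        using fold_flip_support[OF \<open>R \<in> set_pmf ?D\<close>] snoc.prems True that by auto
      then show ?thesis using snoc.prems(2) by (simp add: unsure_def)
    qed
    then have "map_pmf ?sw (bind_pmf ?D (flip \<delta> s m p)) = bind_pmf ?D (flip \<delta> s m p)"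
      unfolding map_bind_pmf by (intro bind_pmf_cong refl map_swap_flip_same)
    then show ?thesis using True by simp
  next
    case False
    then have "map_pmf ?sw ?D = ?D" using snoc by auto
    have "map_pmf ?sw (bind_pmf ?D (flip \<delta> s m p')) = bind_pmf ?D (\<lambda>R. flip \<delta> s m p' (?sw R))"
      unfolding map_bind_pmf using False snoc.prems
      by (intro bind_pmf_cong refl map_swap_flip_other) auto
    also have "\<dots> = bind_pmf (map_pmf ?sw ?D) (flip \<delta> s m p')"
      by (simp add: bind_map_pmf)
    finally show ?thesis using \<open>map_pmf ?sw ?D = ?D\<close> by simp
  qed
qed auto

lemma display_swap_invariant:
  assumes "p \<in> acts K t" "unsure \<delta> s m p Rb"
  shows "map_pmf (\<lambda>R. swap_pos R p (Suc p)) (display K \<delta> t s m Rb) = display K \<delta> t s m Rb"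
  unfolding display_eq_fold using assms
  by (intro fold_flip_swap_invariant) (auto simp: set_acts_list distinct_acts_list acts_Suc_notin)

section \<open>Increments of the pair statistics\<close>

definition incr :: "rlist \<Rightarrow> (nat \<Rightarrow> bool) \<Rightarrow> nat \<Rightarrow> nat \<Rightarrow> nat \<Rightarrow> int" where
  "incr R c p x y = (of_bool (x = R p \<and> y = R (Suc p)) - of_bool (x = R (Suc p) \<and> y = R p))
      * (of_bool (c p) - of_bool (c (Suc p)))"

text \<open>The first factor of \<open>incr\<close> is the orientation of \<open>(x, y)\<close> at
  \<open>p\<close> and vanishes for all other pairs. In these terms the update is a sum over the
  compared pairs, independent of the order of the loop.\<close>

lemma upd_stats_eq:
  assumes "inj R"
  shows "upd_stats K t R c (s, m) =
    (\<lambda>x y. s x y + (\<Sum>p\<in>acts K t. incr R c p x y),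
     \<lambda>x y. m x y + (\<Sum>p\<in>acts K t. nat \<bar>incr R c p x y\<bar>))"
proof -
  define u where "u = (\<lambda>p (s :: nat \<Rightarrow> nat \<Rightarrow> int, m :: nat \<Rightarrow> nat \<Rightarrow> nat).
     let i = R p; j = R (Suc p) in
          if c p \<noteq> c (Suc p) then
            (s(i := (s i)(j := s i j + (of_bool (c p) - of_bool (c (Suc p)))),
               j := (s j)(i := s j i + (of_bool (c (Suc p)) - of_bool (c p)))),
             m(i := (m i)(j := m i j + 1), j := (m j)(i := m j i + 1)))
          else (s, m))"
  have *: "2 * k + t mod 2 = Suc (2 * k - 1 + t mod 2)" if "k \<in> set [1..<(K - t mod 2) div 2 + 1]" for k
    using that by auto
  have eq: "upd_stats K t R c (s, m) = fold u (acts_list K t) (s, m)"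
    unfolding upd_stats_def acts_list_def fold_map Let_def
    by (rule fold_cong) (auto simp: fun_eq_iff u_def * Let_def)
  \<comment> \<open>For distinct items the two nested updates affect different rows, so neither
    overwrites the other.\<close>
  have step: "u p (s, m) = (\<lambda>x y. s x y + incr R c p x y, \<lambda>x y. m x y + nat \<bar>incr R c p x y\<bar>)"
    if "R p \<noteq> R (Suc p)" for p s m
    using that unfolding u_def incr_def
    by (cases "c p = c (Suc p)") (auto simp: Let_def fun_upd_def intro!: ext)
  have fold: "distinct ps \<Longrightarrow> fold u ps (s, m) =
    (\<lambda>x y. s x y + (\<Sum>p\<in>set ps. incr R c p x y),
     \<lambda>x y. m x y + (\<Sum>p\<in>set ps. nat \<bar>incr R c p x y\<bar>))" for ps
  proof (induction ps rule: rev_induct)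
    case (snoc p ps)
    have "R p \<noteq> R (Suc p)" using assms by (simp add: inj_eq)
    moreover have "fold u (ps @ [p]) (s, m) = u p (\<lambda>x y. s x y + (\<Sum>p\<in>set ps. incr R c p x y),
     \<lambda>x y. m x y + (\<Sum>p\<in>set ps. nat \<bar>incr R c p x y\<bar>))"
      using snoc by simp
    ultimately show ?case using snoc.prems by (simp add: step add_ac)
  qed simp
  show ?thesis unfolding eq fold[OF distinct_acts_list] set_acts_list ..
qed

lemma incr_at:
  assumes "R p = i" "R (Suc p) = j" "i \<noteq> j"
  shows "incr R c p i j = of_bool (c p) - of_bool (c (Suc p))"
    and "incr R c p j i = of_bool (c (Suc p)) - of_bool (c p)"
  unfolding incr_def using assms by simp_all

lemma incr_antisym: "incr R c p y x = - incr R c p x y"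
  unfolding incr_def conj_commute[of "y = _"] by (simp add: algebra_simps)

lemma incr_values: "incr R c p x y \<in> {-1, 0, 1}"
proof -
  have "(of_bool P - of_bool Q) * (of_bool u - of_bool v) \<in> {-1, 0, 1::int}" for P Q u v
    by (cases P; cases Q; cases u; cases v) simp_all
  then show ?thesis unfolding incr_def .
qed

lemma incr_nonzero_unique:
  assumes "inj R" "p \<in> acts K t" "p' \<in> acts K t" "{x, y} = {R p, R (Suc p)}" "incr R c p' x y \<noteq> 0"
  shows "p' = p"
proof -
  have "R p' \<in> {x, y}" using assms(5) by (auto simp: incr_def of_bool_def split: if_splits)
  then have "R p' = R p \<or> R p' = R (Suc p)" using assms(4) by blast
  then have "p' = p \<or> p' = Suc p" using assms(1) by (simp add: inj_eq)
  then show ?thesis using acts_Suc_notin assms(2,3) by auto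
qed

lemma sum_incr_active:
  assumes "inj R" "p \<in> acts K t" "{x, y} = {R p, R (Suc p)}"
  shows "(\<Sum>p\<in>acts K t. incr R c p x y) = incr R c p x y"
    and "(\<Sum>p\<in>acts K t. nat \<bar>incr R c p x y\<bar>) = nat \<bar>incr R c p x y\<bar>"
proof -
  have z: "incr R c p' x y = 0" if "p' \<in> acts K t - {p}" for p'
    using incr_nonzero_unique[OF assms(1,2) _ assms(3)] that by blast
  show "(\<Sum>p\<in>acts K t. incr R c p x y) = incr R c p x y"
    using sum.remove[OF finite_acts assms(2), of "\<lambda>p. incr R c p x y"] z by simp
  show "(\<Sum>p\<in>acts K t. nat \<bar>incr R c p x y\<bar>) = nat \<bar>incr R c p x y\<bar>"
    using sum.remove[OF finite_acts assms(2), of "\<lambda>p. nat \<bar>incr R c p x y\<bar>"] z by simp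
qed

lemma sum_incr_inactive:
  assumes "\<And>p. p \<in> acts K t \<Longrightarrow> {x, y} \<noteq> {R p, R (Suc p)}"
  shows "(\<Sum>p\<in>acts K t. incr R c p x y) = 0"
    and "(\<Sum>p\<in>acts K t. nat \<bar>incr R c p x y\<bar>) = 0"
proof -
  have "incr R c p x y = 0" if "p \<in> acts K t" for p
    using assms[OF that] unfolding incr_def by fastforce
  then show "(\<Sum>p\<in>acts K t. incr R c p x y) = 0"
    "(\<Sum>p\<in>acts K t. nat \<bar>incr R c p x y\<bar>) = 0" by simp_all
qed

section \<open>Updates of the base list\<close>

definition viol :: "(nat \<Rightarrow> real) \<Rightarrow> rlist \<Rightarrow> nat \<Rightarrow> real" where
  "viol \<alpha> R p = max 0 (\<alpha> (R (Suc p)) - \<alpha> (R p))"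

text \<open>The smaller index comes first, so the value is the same for both orders of the two items
  and its first component is the more attractive one.\<close>

definition adj_pair :: "rlist \<Rightarrow> nat \<Rightarrow> nat \<times> nat" where
  "adj_pair R p = (min (R p) (R (Suc p)), max (R p) (R (Suc p)))"

text \<open>Such positions can survive a pass of \<open>upd_base\<close>: an exchange at
  \<open>k\<close> brings two items together at \<open>k - 1\<close>, a position that the pass has
  already visited.\<close>

definition confident_wrong :: "real \<Rightarrow> nat \<Rightarrow> (nat \<Rightarrow> nat \<Rightarrow> int) \<Rightarrow> (nat \<Rightarrow> nat \<Rightarrow> nat) \<Rightarrow> rlist \<Rightarrow> nat set" where
  "confident_wrong \<delta> K s m R =
     {p \<in> {1..<K}. real_of_int (s (R (Suc p)) (R p)) > thr \<delta> (m (R (Suc p)) (R p))}"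

definition good :: "real \<Rightarrow> nat \<Rightarrow> (nat \<Rightarrow> nat \<Rightarrow> int) \<Rightarrow> (nat \<Rightarrow> nat \<Rightarrow> nat) \<Rightarrow> bool" where
  "good \<delta> K s m \<longleftrightarrow> (\<forall>i j. 1 \<le> i \<and> i < j \<and> j \<le> K \<longrightarrow> real_of_int (s j i) \<le> thr \<delta> (m j i))"

lemma finite_badpairs [simp]: "finite (badpairs K R)"
  by (rule finite_subset[of _ "{1..K} \<times> {1..K}"]) (auto simp: badpairs_def)

lemma finite_confident_wrong [simp]: "finite (confident_wrong \<delta> K s m R)"
  by (auto simp: confident_wrong_def)

lemma thr_nonneg: "0 < \<delta> \<Longrightarrow> \<delta> < 1 \<Longrightarrow> thr \<delta> b \<ge> 0"
  by (simp add: thr_def)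

lemma lists_K_in: "R \<in> lists_K K \<Longrightarrow> p \<in> {1..K} \<Longrightarrow> R p \<in> {1..K}"
  using permutes_in_image[of R "{1..K}" p] by (auto simp: lists_K_def)

lemma lists_K_inj: "R \<in> lists_K K \<Longrightarrow> inj R"
  by (auto simp: lists_K_def permutes_inj)

lemma adj_inversion_badpair:
  assumes "R \<in> lists_K K" "k \<in> {1..<K}" "R (Suc k) < R k"
  shows "(R (Suc k), R k) \<in> badpairs K R"
  using assms lists_K_in[OF assms(1), of k] lists_K_in[OF assms(1), of "Suc k"]
  by (simp add: badpairs_def inv_f_f[OF lists_K_inj[OF assms(1)]])

text \<open>Transposing two neighbouring positions alters the relative order of these two positions
  only.\<close>

lemma badpairs_swap:
  assumes R: "R \<in> lists_K K" and k: "k \<in> {1..<K}" and lt: "R (Suc k) < R k"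
  shows "badpairs K (swap_pos R k (Suc k)) = badpairs K R - {(R (Suc k), R k)}"
proof -
  have p: "R permutes {1..K}" using R by (simp add: lists_K_def)
  have bij: "bij R" using p by (rule permutes_bij)
  have inv: "inv (swap_pos R k (Suc k)) i = Transposition.transpose k (Suc k) (inv R i)" for i
    unfolding swap_pos_def using bij by (subst o_inv_distrib) auto
  have Rinv: "R (inv R i) = i" for i using bij by (simp add: bij_is_surj surj_f_inv_f)
  have "(i, j) \<in> badpairs K (swap_pos R k (Suc k)) \<longleftrightarrow> (i, j) \<in> badpairs K R - {(R (Suc k), R k)}"
    for i j
  proof (cases "i < j")
    case True
    define x y where "x = inv R i" "y = inv R j"
    have xy: "R x = i" "R y = j" by (simp_all add: x_y_def Rinv)
    have "x \<noteq> y" using xy True by auto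
    have "\<not> (x = k \<and> y = Suc k)" using xy True lt by auto
    then have "Transposition.transpose k (Suc k) x > Transposition.transpose k (Suc k) y \<longleftrightarrow> x > y \<and> \<not> (x = Suc k \<and> y = k)"
      using \<open>x \<noteq> y\<close> by (auto simp: Transposition.transpose_def)
    moreover have "x = Suc k \<and> y = k \<longleftrightarrow> (i, j) = (R (Suc k), R k)"
      using xy lists_K_inj[OF R] by (auto simp: inj_eq)
    ultimately show ?thesis using True by (auto simp: badpairs_def inv x_y_def)
  qed (auto simp: badpairs_def)
  then show ?thesis by auto
qed

lemma viol_bounds:
  assumes "R \<in> lists_K K" "\<And>i. i \<in> {1..K} \<Longrightarrow> 0 \<le> \<alpha> i \<and> \<alpha> i \<le> 1" "p \<in> {1..<K}"
  shows "0 \<le> viol \<alpha> R p" "viol \<alpha> R p \<le> 1"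
  using assms(2)[OF lists_K_in[OF assms(1)], of p] assms(2)[OF lists_K_in[OF assms(1)], of "Suc p"] assms(3)
  by (auto simp: viol_def)

text \<open>The exchange affects at most the three neighbour pairs starting at \<open>k - 1\<close>,
  \<open>k\<close> and \<open>Suc k\<close>, and each of them contributes a value between 0 and
  1.\<close>

lemma sum_viol_swap:
  assumes R: "R \<in> lists_K K" and k: "k \<in> {1..<K}"
    and al: "\<And>i. i \<in> {1..K} \<Longrightarrow> 0 \<le> \<alpha> i \<and> \<alpha> i \<le> 1"
  shows "(\<Sum>p\<in>acts K t. viol \<alpha> R p) \<le> (\<Sum>p\<in>acts K t. viol \<alpha> (swap_pos R k (Suc k)) p) + 3"
proof -
  let ?R = "swap_pos R k (Suc k)"
  have R': "?R \<in> lists_K K" using R k by (intro swap_pos_lists_K) auto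
  have "viol \<alpha> R p \<le> viol \<alpha> ?R p + of_bool (p \<in> {k - 1, k, Suc k})" if "p \<in> acts K t" for p
  proof (cases "p \<in> {k - 1, k, Suc k}")
    case True
    have p: "p \<in> {1..<K}" using that by (auto simp: acts_def)
    show ?thesis using True viol_bounds[where \<alpha> = \<alpha>, OF R _ p] viol_bounds[where \<alpha> = \<alpha>, OF R' _ p] al
      by fastforce
  next
    case False
    then have "?R p = R p" "?R (Suc p) = R (Suc p)" using k by (auto intro!: swap_pos_apply(3))
    then show ?thesis by (simp add: viol_def)
  qed
  then have "(\<Sum>p\<in>acts K t. viol \<alpha> R p) \<le> (\<Sum>p\<in>acts K t. viol \<alpha> ?R p + of_bool (p \<in> {k - 1, k, Suc k}))"
    by (rule sum_mono)
  also have "\<dots> = (\<Sum>p\<in>acts K t. viol \<alpha> ?R p) + (\<Sum>p\<in>acts K t. of_bool (p \<in> {k - 1, k, Suc k}))"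
    by (rule sum.distrib)
  also have "(\<Sum>p\<in>acts K t. of_bool (p \<in> {k - 1, k, Suc k}) :: real) \<le> 3"
  proof -
    have "(\<Sum>p\<in>acts K t. of_bool (p \<in> {k - 1, k, Suc k}) :: real)
        = real (card (acts K t \<inter> {k - 1, k, Suc k}))"
      by (simp only: sum_of_bool_eq finite_acts Collect_mem_eq)
    moreover have "card (acts K t \<inter> {k - 1, k, Suc k}) \<le> card {k - 1, k, Suc k}"
      by (intro card_mono) auto
    moreover have "card {k - 1, k, Suc k} \<le> 3"
      by (intro order_trans[OF card_insert_le_m1]) auto
    ultimately show ?thesis by linarith
  qed
  finally show ?thesis by simp
qed

lemma adj_pair_swap:
  assumes "k \<in> {1..<K}"
  shows "adj_pair (swap_pos R k (Suc k)) ` {1..<K}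
    \<subseteq> adj_pair R ` {1..<K} \<union> {adj_pair (swap_pos R k (Suc k)) (k - 1), adj_pair (swap_pos R k (Suc k)) (Suc k)}"
proof
  let ?R = "swap_pos R k (Suc k)"
  fix z assume "z \<in> adj_pair ?R ` {1..<K}"
  then obtain p where p: "p \<in> {1..<K}" "z = adj_pair ?R p" by auto
  consider "p = k" | "p = k - 1" | "p = Suc k" | "p \<noteq> k" "Suc p \<noteq> k" "p \<noteq> Suc k"
    by force
  then show "z \<in> adj_pair R ` {1..<K} \<union> {adj_pair ?R (k - 1), adj_pair ?R (Suc k)}"
  proof cases
    case 1
    then have "z = adj_pair R p"
      using p by (simp add: adj_pair_def swap_pos_apply min.commute max.commute)
    then show ?thesis using p by auto
  next
    case 4
    then have "z = adj_pair R p" using p by (simp add: adj_pair_def swap_pos_apply)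
    then show ?thesis using p by auto
  qed (use p in auto)
qed

definition base_step :: "real \<Rightarrow> (nat \<Rightarrow> nat \<Rightarrow> int) \<Rightarrow> (nat \<Rightarrow> nat \<Rightarrow> nat) \<Rightarrow> nat \<Rightarrow> rlist \<Rightarrow> rlist" where
  "base_step \<delta> s m k R =
     (if real_of_int (s (R (Suc k)) (R k)) > thr \<delta> (m (R (Suc k)) (R k))
      then swap_pos R k (Suc k) else R)"

lemma upd_base_eq_fold: "upd_base K \<delta> s m Rb = fold (base_step \<delta> s m) [1..<K] Rb"
proof -
  have "base_step \<delta> s m = (\<lambda>k R. let i = R k; j = R (k+1) in
                 if real_of_int (s j i) > 2 * sqrt (real (m j i) * ln (1/\<delta>))
                 then swap_pos R k (k+1) else R)"
    by (simp add: fun_eq_iff base_step_def thr_def)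
  then show ?thesis by (simp only: upd_base_def)
qed

text \<open>Loop invariant of the pass over the base list, where \<open>N\<close> counts the
  exchanges made so far. By \<open>good\<close> every exchange corrects an inversion. Confidently
  wrong positions are counted only below \<open>k\<close>, the part already visited.\<close>

lemma upd_base_prefix:
  assumes Rb: "Rb \<in> lists_K K" and good: "good \<delta> K s m" and \<delta>: "0 < \<delta>" "\<delta> < 1"
    and anti: "\<And>i j. s j i = - s i j"
    and al: "\<And>i. i \<in> {1..K} \<Longrightarrow> 0 \<le> \<alpha> i \<and> \<alpha> i \<le> 1"
    and k: "1 \<le> k" "k \<le> K"
  shows "\<exists>N R. R = fold (base_step \<delta> s m) [1..<k] Rb
    \<and> R \<in> lists_K K \<and> card (badpairs K R) + N = card (badpairs K Rb)
    \<and> card (adj_pair R ` {1..<K} - adj_pair Rb ` {1..<K}) \<le> 2 * N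
    \<and> card {p \<in> confident_wrong \<delta> K s m R. p < k} \<le> N
    \<and> (\<Sum>p\<in>acts K t. viol \<alpha> Rb p) \<le> (\<Sum>p\<in>acts K t. viol \<alpha> R p) + 3 * real N"
    (is "\<exists>N R. R = _ \<and> ?P k N R")
  using k
proof (induction k rule: nat_induct_at_least)
  case base
  show ?case
    by (intro exI[of _ 0] exI[of _ Rb] conjI) (auto simp: Rb confident_wrong_def)
next
  case (Suc k)
  then obtain N R where R: "R = fold (base_step \<delta> s m) [1..<k] Rb" and P: "?P k N R" by auto
  have RK: "R \<in> lists_K K" and bad: "card (badpairs K R) + N = card (badpairs K Rb)"
    and adj: "card (adj_pair R ` {1..<K} - adj_pair Rb ` {1..<K}) \<le> 2 * N"
    and cw: "card {p \<in> confident_wrong \<delta> K s m R. p < k} \<le> N"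
    and vi: "(\<Sum>p\<in>acts K t. viol \<alpha> Rb p) \<le> (\<Sum>p\<in>acts K t. viol \<alpha> R p) + 3 * real N"
    using P by blast+
  have kK: "k \<in> {1..<K}" using Suc by auto
  let ?R' = "swap_pos R k (Suc k)"
  have fold': "fold (base_step \<delta> s m) [1..<Suc k] Rb = base_step \<delta> s m k R"
    using Suc(1) by (simp add: R)
  show ?case
  proof (cases "real_of_int (s (R (Suc k)) (R k)) > thr \<delta> (m (R (Suc k)) (R k))")
    case False
    have "{p \<in> confident_wrong \<delta> K s m R. p < Suc k} = {p \<in> confident_wrong \<delta> K s m R. p < k}"
      using False by (auto simp: confident_wrong_def less_Suc_eq)
    then show ?thesis
      using False RK bad adj cw vi unfolding fold' by (intro exI[of _ N] exI[of _ R]) (simp add: base_step_def)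
  next
    case True
    have in1: "R k \<in> {1..K}" "R (Suc k) \<in> {1..K}" 
      by (rule lists_K_in[OF RK], use kK in simp)+
    have "R k \<noteq> R (Suc k)" using lists_K_inj[OF RK] by (simp add: inj_eq)
    moreover have "\<not> R k < R (Suc k)"
      using good True in1 unfolding good_def by (meson atLeastAtMost_iff not_le)
    ultimately have lt: "R (Suc k) < R k" by simp
    have R'K: "?R' \<in> lists_K K" using RK kK by (intro swap_pos_lists_K) auto
    have bad': "card (badpairs K ?R') + Suc N = card (badpairs K Rb)"
      using bad card.remove[OF finite_badpairs adj_inversion_badpair[OF RK kK lt]]
      unfolding badpairs_swap[OF RK kK lt] by simp
    have adj': "card (adj_pair ?R' ` {1..<K} - adj_pair Rb ` {1..<K}) \<le> 2 * Suc N"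
    proof -
      let ?n = "{adj_pair ?R' (k - 1), adj_pair ?R' (Suc k)}"
      have "adj_pair ?R' ` {1..<K} - adj_pair Rb ` {1..<K}
          \<subseteq> (adj_pair R ` {1..<K} - adj_pair Rb ` {1..<K}) \<union> ?n"
        using adj_pair_swap[OF kK, of R] by auto
      then have "card (adj_pair ?R' ` {1..<K} - adj_pair Rb ` {1..<K})
          \<le> card ((adj_pair R ` {1..<K} - adj_pair Rb ` {1..<K}) \<union> ?n)"
        by (intro card_mono) auto
      also have "\<dots> \<le> card (adj_pair R ` {1..<K} - adj_pair Rb ` {1..<K}) + card ?n"
        by (rule card_Un_le)
      also have "card ?n \<le> 2" by (simp add: card_insert_if)
      finally show ?thesis using adj by simp
    qed
    have cw': "card {p \<in> confident_wrong \<delta> K s m ?R'. p < Suc k} \<le> Suc N"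
    proof -
      \<comment> \<open>The statistic is antisymmetric and thresholds are nonnegative, so a pair
        cannot be confident in both directions; the pair just exchanged is settled.\<close>
      have "\<not> real_of_int (s (R k) (R (Suc k))) > thr \<delta> (m (R k) (R (Suc k)))"
        using True thr_nonneg[OF \<delta>, of "m (R (Suc k)) (R k)"] thr_nonneg[OF \<delta>, of "m (R k) (R (Suc k))"]
          anti[of "R k" "R (Suc k)"] by linarith
      then have "k \<notin> confident_wrong \<delta> K s m ?R'"
        by (simp add: confident_wrong_def swap_pos_apply)
      \<comment> \<open>Among the positions before \<open>k\<close>, only \<open>k - 1\<close> has
        received a new right neighbour; it is the one position that the exchange may add to the
        count.\<close>
      moreover have "p \<in> confident_wrong \<delta> K s m R"
        if "p \<in> confident_wrong \<delta> K s m ?R'" "p < k" "Suc p \<noteq> k" for p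
        using that by (simp add: confident_wrong_def swap_pos_apply)
      ultimately have "{p \<in> confident_wrong \<delta> K s m ?R'. p < Suc k}
          \<subseteq> insert (k - 1) {p \<in> confident_wrong \<delta> K s m R. p < k}"
        by (auto simp: less_Suc_eq)
      then have "card {p \<in> confident_wrong \<delta> K s m ?R'. p < Suc k}
          \<le> card (insert (k - 1) {p \<in> confident_wrong \<delta> K s m R. p < k})"
        by (intro card_mono) auto
      also have "\<dots> \<le> Suc (card {p \<in> confident_wrong \<delta> K s m R. p < k})"
        by (simp add: card_insert_if)
      finally show ?thesis using cw by simp
    qed
    have "(\<Sum>p\<in>acts K t. viol \<alpha> Rb p) \<le> (\<Sum>p\<in>acts K t. viol \<alpha> ?R' p) + 3 * real (Suc N)"
      using vi sum_viol_swap[OF RK kK, of \<alpha> t] al by simp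
    then show ?thesis
      using True R'K bad' adj' cw' unfolding fold' by (intro exI[of _ "Suc N"] exI[of _ ?R']) (simp add: base_step_def)
  qed
qed

lemma upd_base_progress:
  assumes "Rb \<in> lists_K K" "good \<delta> K s m" "0 < \<delta>" "\<delta> < 1"
    and "\<And>i j. s j i = - s i j"
    and "\<And>i. i \<in> {1..K} \<Longrightarrow> 0 \<le> \<alpha> i \<and> \<alpha> i \<le> 1" and "1 \<le> K"
  obtains N where "card (badpairs K (upd_base K \<delta> s m Rb)) + N = card (badpairs K Rb)"
    "card (adj_pair (upd_base K \<delta> s m Rb) ` {1..<K} - adj_pair Rb ` {1..<K}) \<le> 2 * N"
    "card (confident_wrong \<delta> K s m (upd_base K \<delta> s m Rb)) \<le> N"
    "(\<Sum>p\<in>acts K t. viol \<alpha> Rb p) \<le> (\<Sum>p\<in>acts K t. viol \<alpha> (upd_base K \<delta> s m Rb) p) + 3 * real N"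
proof -
  have "{p \<in> confident_wrong \<delta> K s m R. p < K} = confident_wrong \<delta> K s m R" for R
    by (auto simp: confident_wrong_def)
  then show ?thesis
    using upd_base_prefix[where k = K and \<alpha> = \<alpha> and t = t, OF assms order_refl] that
    unfolding upd_base_eq_fold by auto
qed

lemma upd_base_lists_K:
  assumes "Rb \<in> lists_K K"
  shows "upd_base K \<delta> s m Rb \<in> lists_K K"
proof -
  have "set ks \<subseteq> {1..<K} \<Longrightarrow> fold (base_step \<delta> s m) ks Rb \<in> lists_K K" for ks
    by (induction ks rule: rev_induct) (auto simp: assms base_step_def intro!: swap_pos_lists_K)
  from this[of "[1..<K]"] show ?thesis unfolding upd_base_eq_fold by simp
qed

section \<open>Drift of the statistics\<close>

lemma expectation_bind_pmf_finite:
  fixes h :: "'b \<Rightarrow> real"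
  assumes "finite (set_pmf p)" "\<And>x. x \<in> set_pmf p \<Longrightarrow> finite (set_pmf (f x))"
  shows "measure_pmf.expectation (bind_pmf p f) h
       = measure_pmf.expectation p (\<lambda>x. measure_pmf.expectation (f x) h)"
  using assms
  by (simp add: pmf_expectation_bind[of "set_pmf p"] integral_measure_pmf[of "set_pmf p"])

lemma expectation_mono_finite:
  fixes f g :: "'a \<Rightarrow> real"
  assumes "finite (set_pmf p)" "\<And>x. x \<in> set_pmf p \<Longrightarrow> f x \<le> g x"
  shows "measure_pmf.expectation p f \<le> measure_pmf.expectation p g"
  using assms by (intro integral_mono_AE integrable_measure_pmf_finite) (auto simp: AE_measure_pmf_iff)

lemma expectation_cong_pmf:
  fixes f g :: "'a \<Rightarrow> real"
  assumes "\<And>x. x \<in> set_pmf p \<Longrightarrow> f x = g x"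
  shows "measure_pmf.expectation p f = measure_pmf.expectation p g"
  using assms by (intro integral_cong_AE) (auto simp: AE_measure_pmf_iff)

lemma prob_pair_pmf_conj:
  "measure_pmf.prob (pair_pmf P Q) {z. U (fst z) \<and> V (snd z)}
     = measure_pmf.prob P {a. U a} * measure_pmf.prob Q {b. V b}"
proof -
  have "emeasure (measure_pmf (pair_pmf P Q)) {z. U (fst z) \<and> V (snd z)}
      = (\<integral>\<^sup>+z. indicator {z. U (fst z) \<and> V (snd z)} z \<partial>pair_pmf P Q)" by simp
  also have "\<dots> = (\<integral>\<^sup>+a. \<integral>\<^sup>+b. indicator {a. U a} a * indicator {b. V b} b \<partial>Q \<partial>P)"
    unfolding nn_integral_pair_pmf' by (intro nn_integral_cong) (auto simp: indicator_def)
  also have "\<dots> = emeasure P {a. U a} * emeasure Q {b. V b}"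
    by (simp add: nn_integral_cmult nn_integral_multc)
  finally have "emeasure (measure_pmf (pair_pmf P Q)) {z. U (fst z) \<and> V (snd z)}
      = emeasure P {a. U a} * emeasure Q {b. V b}" .
  then show ?thesis
    by (simp add: measure_pmf.emeasure_eq_measure flip: ennreal_mult)
qed

text \<open>To be read with attraction probabilities \<open>x\<close>, \<open>y\<close> of the
  better and the worse item and examination weights \<open>P\<close>, \<open>Q\<close>. The second
  inequality says that the mean step is at least \<open>(x - y) / (x + y)\<close> times the total
  click weight.\<close>

lemma weighted_difference_ge:
  fixes P Q x y :: real
  assumes "Q \<le> P" "0 \<le> y" "y \<le> x"
  shows "P * (x - y) \<le> P * x - Q * y"
    and "(x - y) * (P * x + Q * y) \<le> (P * x - Q * y) * (x + y)"
proof -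
  have "Q * y \<le> P * y" using assms by (intro mult_right_mono)
  then show "P * (x - y) \<le> P * x - Q * y" by (simp add: algebra_simps)
  have "0 \<le> 2 * x * y * (P - Q)" using assms by simp
  also have "\<dots> = (P * x - Q * y) * (x + y) - (x - y) * (P * x + Q * y)"
    by (simp add: algebra_simps)
  finally show "(x - y) * (P * x + Q * y) \<le> (P * x - Q * y) * (x + y)" by simp
qed

lemma finite_lists_K [simp]: "finite (lists_K K)"
  unfolding lists_K_def by (rule finite_permutations) simp

lemma id_lists_K [simp]: "id \<in> lists_K K"
  by (simp add: lists_K_def permutes_id)

text \<open>The main case of the theorem. \<open>2 <= K\<close> ensures that there is an adjacent
  gap, and the bound on \<delta> makes \<open>ln (1 / \<delta>)\<close> large enough to absorb
  additive constants.\<close>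

locale bubble_rank =
  fixes PA :: "(nat \<Rightarrow> bool) pmf" and PX :: "(rlist \<Rightarrow> nat \<Rightarrow> bool) pmf" and K :: nat and \<delta> :: real
  assumes A1: "\<forall>R \<in> lists_K K. rew K (attr PA) (exam PX) R \<le> rew K (attr PA) (exam PX) id"
    and A2: "\<forall>R \<in> lists_K K. \<forall>R' \<in> lists_K K. \<forall>k \<in> {1..K}.
               R ` {1..<k} = R' ` {1..<k} \<longrightarrow> exam PX R k = exam PX R' k"
    and A3: "\<forall>R \<in> lists_K K. \<forall>k l. 1 \<le> k \<and> k < l \<and> l \<le> K \<longrightarrow> exam PX R k \<ge> exam PX R l"
    and A4: "\<forall>R \<in> lists_K K. \<forall>R' \<in> lists_K K. \<forall>k l. 1 \<le> k \<and> k < l \<and> l \<le> K \<and>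
               R' = swap_pos R k l \<longrightarrow> (attr PA (R k) \<le> attr PA (R l) \<longleftrightarrow> exam PX R l \<ge> exam PX R' l)"
    and A5: "\<forall>R \<in> lists_K K. \<forall>k \<in> {1..K}. exam PX R k \<ge> exam PX id k"
    and decr: "\<forall>k \<in> {1..<K}. attr PA k > attr PA (k+1)"
    and pos: "attr PA K > 0"
    and chi_min_pos: "exam PX id K > 0"
    and K_ge_2: "2 \<le> K"
    and delta: "0 < \<delta>" "\<delta> < 1 / 16"
begin

abbreviation alpha :: "nat \<Rightarrow> real" where "alpha \<equiv> attr PA"
abbreviation chi :: "rlist \<Rightarrow> nat \<Rightarrow> real" where "chi \<equiv> exam PX"
abbreviation chi_max :: real where "chi_max \<equiv> chi id 1"
abbreviation chi_min :: real where "chi_min \<equiv> chi id K"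

definition L :: real where "L = ln (1 / \<delta>)"

definition gap_min :: real where
  "gap_min = Min ((\<lambda>k. alpha k - alpha (k+1)) ` {1..<K})"

section \<open>Bounds on attraction and examination probabilities\<close>

lemma delta_lt_1: "\<delta> < 1"
  using delta by simp

lemma alpha_bounds: "0 \<le> alpha i" "alpha i \<le> 1"
  by (simp_all add: attr_def)

lemma chi_nonneg: "0 \<le> chi R k"
  by (simp add: exam_def)

lemma chi_le_1: "chi R k \<le> 1"
  by (simp add: exam_def)

lemma gap_min_pos: "gap_min > 0"
  unfolding gap_min_def using decr K_ge_2 by (subst Min_gr_iff) auto

lemma adjacent_gap: "k \<in> {1..<K} \<Longrightarrow> gap_min \<le> alpha k - alpha (Suc k)"
  unfolding gap_min_def by (rule Min_le) auto

lemma alpha_gap: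
  assumes "1 \<le> i" "i < j" "j \<le> K"
  shows "gap_min \<le> alpha i - alpha j"
proof -
  have "Suc i \<le> j" using assms by simp
  then show ?thesis using assms(3)
  proof (induction j rule: nat_induct_at_least)
    case base
    then show ?case using assms(1) adjacent_gap[of i] by simp
  next
    case (Suc j)
    then show ?case using adjacent_gap[of j] gap_min_pos by simp
  qed
qed

lemma alpha_strict: "1 \<le> i \<Longrightarrow> i < j \<Longrightarrow> j \<le> K \<Longrightarrow> alpha j < alpha i"
  using alpha_gap[of i j] gap_min_pos by simp

lemma alpha_antimono: "1 \<le> i \<Longrightarrow> i \<le> j \<Longrightarrow> j \<le> K \<Longrightarrow> alpha j \<le> alpha i"
  using alpha_strict[of i j] by (cases "i = j") auto

lemma alpha_pos: "1 \<le> i \<Longrightarrow> i \<le> K \<Longrightarrow> alpha i > 0"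
  using alpha_antimono[of i K] pos by simp

lemma chi_decreasing: "R \<in> lists_K K \<Longrightarrow> 1 \<le> k \<Longrightarrow> k \<le> l \<Longrightarrow> l \<le> K \<Longrightarrow> chi R l \<le> chi R k"
  using A3 by (cases "k = l") auto

text \<open>Position 1 has an empty prefix, so by A2 it is examined with the same probability in
  every list; A3 handles the other positions.\<close>

lemma chi_le_max: "R \<in> lists_K K \<Longrightarrow> k \<in> {1..K} \<Longrightarrow> chi R k \<le> chi_max"
proof -
  assume R: "R \<in> lists_K K" and k: "k \<in> {1..K}"
  have "chi R 1 = chi id 1" using A2[rule_format, OF R id_lists_K, of 1] K_ge_2 by simp
  then show ?thesis using chi_decreasing[OF R, of 1 k] k by simp
qed

lemma chi_ge_min: "R \<in> lists_K K \<Longrightarrow> k \<in> {1..K} \<Longrightarrow> chi_min \<le> chi R k"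
  using chi_decreasing[OF id_lists_K, of k K] A5 by fastforce

lemma chi_max_pos: "chi_max > 0"
  using chi_ge_min[OF id_lists_K, of 1] chi_min_pos K_ge_2 by simp

text \<open>Clicks are cut off outside \<open>{1..K}\<close>, which makes the support finite.\<close>

definition outcomes :: "nat \<Rightarrow> (nat \<Rightarrow> nat \<Rightarrow> int) \<Rightarrow> (nat \<Rightarrow> nat \<Rightarrow> nat) \<Rightarrow> rlist \<Rightarrow> (rlist \<times> (nat \<Rightarrow> bool)) pmf" where
  "outcomes t s m Rb = bind_pmf (display K \<delta> t s m Rb) (\<lambda>R.
     map_pmf (\<lambda>z. (R, \<lambda>k. k \<in> {1..K} \<and> snd z R k \<and> fst z (R k))) (pair_pmf PA PX))"

definition next_state :: "nat \<Rightarrow> (nat \<Rightarrow> nat \<Rightarrow> int) \<Rightarrow> (nat \<Rightarrow> nat \<Rightarrow> nat) \<Rightarrow> rlist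
    \<Rightarrow> rlist \<times> (nat \<Rightarrow> bool) \<Rightarrow> bstate" where
  "next_state t s m Rb w = (let sm = upd_stats K t (fst w) (snd w) (s, m)
     in (fst sm, snd sm, upd_base K \<delta> (fst sm) (snd sm) Rb))"

lemma upd_stats_cong:
  assumes "inj R" "\<And>k. k \<in> {1..K} \<Longrightarrow> c k = c' k"
  shows "upd_stats K t R c (s, m) = upd_stats K t R c' (s, m)"
proof -
  have "incr R c p = incr R c' p" if "p \<in> acts K t" for p
    using assms(2)[of p] assms(2)[of "Suc p"] that by (auto simp: acts_def fun_eq_iff incr_def)
  then show ?thesis by (simp add: upd_stats_eq[OF assms(1)])
qed

lemma bubble_step_eq:
  assumes "Rb \<in> lists_K K"
  shows "bubble_step PA PX K \<delta> t (s, m, Rb) = map_pmf (next_state t s m Rb) (outcomes t s m Rb)"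
proof -
  have *: "upd_stats K t R (\<lambda>k. X R k \<and> A (R k)) (s, m)
      = upd_stats K t R (\<lambda>k. k \<in> {1..K} \<and> X R k \<and> A (R k)) (s, m)"
    if "R \<in> set_pmf (display K \<delta> t s m Rb)" for R A X
    using lists_K_inj[OF display_lists_K[OF assms that]] by (intro upd_stats_cong) auto
  show ?thesis
    unfolding bubble_step_def outcomes_def pair_pmf_def map_bind_pmf map_pmf_comp prod.case
    by (intro bind_pmf_cong refl)
       (simp add: map_bind_pmf next_state_def Let_def *)
qed

lemma finite_display: "Rb \<in> lists_K K \<Longrightarrow> finite (set_pmf (display K \<delta> t s m Rb))"
  by (rule finite_subset[OF _ finite_lists_K[of K]]) (auto intro: display_lists_K)

lemma finite_clicks:
  "finite (set_pmf (map_pmf (\<lambda>z. (R :: rlist, \<lambda>k. k \<in> {1..K} \<and> snd z R k \<and> fst z (R k))) (pair_pmf PA PX)))"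
proof (rule finite_subset)
  show "finite ({R} \<times> (\<lambda>S k. k \<in> S) ` Pow {1..K})" by simp
  have "(\<lambda>k. k \<in> {1..K} \<and> snd z R k \<and> fst z (R k)) \<in> (\<lambda>S k. k \<in> S) ` Pow {1..K}" for z
    by (rule image_eqI[of _ _ "{k \<in> {1..K}. snd z R k \<and> fst z (R k)}"]) auto
  then show "set_pmf (map_pmf (\<lambda>z. (R, \<lambda>k. k \<in> {1..K} \<and> snd z R k \<and> fst z (R k))) (pair_pmf PA PX))
      \<subseteq> {R} \<times> (\<lambda>S k. k \<in> S) ` Pow {1..K}"
    by (auto simp del: atLeastAtMost_iff)
qed

lemma finite_outcomes: "Rb \<in> lists_K K \<Longrightarrow> finite (set_pmf (outcomes t s m Rb))"
  unfolding outcomes_def set_bind_pmf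
  by (intro finite_UN_I finite_display finite_clicks)

lemma outcomes_support:
  assumes "Rb \<in> lists_K K" "w \<in> set_pmf (outcomes t s m Rb)"
  shows "fst w \<in> set_pmf (display K \<delta> t s m Rb)" "fst w \<in> lists_K K" "inj (fst w)"
proof -
  show *: "fst w \<in> set_pmf (display K \<delta> t s m Rb)" using assms(2) by (auto simp: outcomes_def)
  then show "fst w \<in> lists_K K" by (rule display_lists_K[OF assms(1)])
  then show "inj (fst w)" by (rule lists_K_inj)
qed

lemma expectation_outcomes:
  fixes f :: "_ \<Rightarrow> real"
  assumes "Rb \<in> lists_K K"
  shows "measure_pmf.expectation (outcomes t s m Rb) f
    = measure_pmf.expectation (display K \<delta> t s m Rb) (\<lambda>R.
        measure_pmf.expectation (map_pmf (\<lambda>z. (R, \<lambda>k. k \<in> {1..K} \<and> snd z R k \<and> fst z (R k))) (pair_pmf PA PX)) f)"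
  unfolding outcomes_def using assms
  by (intro expectation_bind_pmf_finite finite_display finite_clicks)

lemma expectation_click:
  assumes "p \<in> {1..K}"
  shows "measure_pmf.expectation (map_pmf (\<lambda>z. (R, \<lambda>k. k \<in> {1..K} \<and> snd z R k \<and> fst z (R k))) (pair_pmf PA PX))
      (\<lambda>w. of_bool (snd w p)) = chi R p * alpha (R p)"
proof -
  have "measure_pmf.expectation (map_pmf (\<lambda>z. (R, \<lambda>k. k \<in> {1..K} \<and> snd z R k \<and> fst z (R k))) (pair_pmf PA PX))
      (\<lambda>w. of_bool (snd w p)) = measure_pmf.expectation (pair_pmf PA PX) (indicator {z. fst z (R p) \<and> snd z R p} :: _ \<Rightarrow> real)"
    using assms by (subst integral_map_pmf, intro expectation_cong_pmf) (auto simp: indicator_def)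
  also have "\<dots> = measure_pmf.prob (pair_pmf PA PX) {z. fst z (R p) \<and> snd z R p}" by simp
  also have "\<dots> = chi R p * alpha (R p)"
    using prob_pair_pmf_conj[of PA PX "\<lambda>A. A (R p)" "\<lambda>X. X R p"]
    by (simp add: attr_def exam_def)
  finally show ?thesis .
qed

text \<open>Here \<open>x\<close> and \<open>y\<close> are the positions of \<open>i\<close> and
  \<open>j\<close>, in either order. The step is the difference of the two clicks, and it can be
  nonzero only if one of them occurs, whence the bound by the sum of the click
  probabilities.\<close>

lemma expectation_incr:
  assumes "p \<in> {1..<K}" "i \<noteq> j" "R x = i" "R y = j" "{x, y} = {p, Suc p}"
  defines "D \<equiv> map_pmf (\<lambda>z. (R, \<lambda>k. k \<in> {1..K} \<and> snd z R k \<and> fst z (R k))) (pair_pmf PA PX)"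
  shows "measure_pmf.expectation D (\<lambda>w. real_of_int (incr (fst w) (snd w) p i j))
      = chi R x * alpha i - chi R y * alpha j"
    and "measure_pmf.expectation D (\<lambda>w. \<bar>real_of_int (incr (fst w) (snd w) p i j)\<bar>)
      \<le> chi R x * alpha i + chi R y * alpha j"
proof -
  have cases: "x = p \<and> y = Suc p \<or> x = Suc p \<and> y = p" using assms(5) by (auto simp: doubleton_eq_iff)
  then have xy: "x \<in> {1..K}" "y \<in> {1..K}" using assms(1) by auto
  have D: "finite (set_pmf D)" unfolding D_def by (rule finite_clicks)
  note int = integrable_measure_pmf_finite[OF D]
  have incr: "real_of_int (incr (fst w) (snd w) p i j) = of_bool (snd w x) - of_bool (snd w y)"
    if "w \<in> set_pmf D" for w
  proof -
    have "fst w = R" using that by (auto simp: D_def)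
    with cases show ?thesis
    proof (elim disjE conjE)
      assume "x = p" "y = Suc p"
      then have "R p = i" "R (Suc p) = j" using assms(3,4) by simp_all
      then show ?thesis
        using incr_at(1)[of R p i j] assms(2) \<open>fst w = R\<close> \<open>x = p\<close> \<open>y = Suc p\<close> by simp
    next
      assume "x = Suc p" "y = p"
      then have "R (Suc p) = i" "R p = j" using assms(3,4) by simp_all
      then show ?thesis
        using incr_at(2)[of R p j i] assms(2) \<open>fst w = R\<close> \<open>x = Suc p\<close> \<open>y = p\<close> by simp
    qed
  qed
  have ex: "measure_pmf.expectation D (\<lambda>w. of_bool (snd w x)) = chi R x * alpha i"
    "measure_pmf.expectation D (\<lambda>w. of_bool (snd w y)) = chi R y * alpha j"
    unfolding D_def
    by (rule expectation_click[OF xy(1), of R, unfolded assms(3)],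
        rule expectation_click[OF xy(2), of R, unfolded assms(4)])
  have "measure_pmf.expectation D (\<lambda>w. real_of_int (incr (fst w) (snd w) p i j))
      = measure_pmf.expectation D (\<lambda>w. of_bool (snd w x) - of_bool (snd w y))"
    by (intro expectation_cong_pmf incr)
  then show "measure_pmf.expectation D (\<lambda>w. real_of_int (incr (fst w) (snd w) p i j))
      = chi R x * alpha i - chi R y * alpha j"
    by (simp add: Bochner_Integration.integral_diff int ex)
  have "measure_pmf.expectation D (\<lambda>w. \<bar>real_of_int (incr (fst w) (snd w) p i j)\<bar>)
      \<le> measure_pmf.expectation D (\<lambda>w. of_bool (snd w x) + of_bool (snd w y))"
    by (intro expectation_mono_finite D) (simp add: incr)
  then show "measure_pmf.expectation D (\<lambda>w. \<bar>real_of_int (incr (fst w) (snd w) p i j)\<bar>)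
      \<le> chi R x * alpha i + chi R y * alpha j"
    by (simp add: Bochner_Integration.integral_add int ex)
qed

text \<open>Over both orders together, item \<open>i\<close> is examined with weight
  \<open>P\<close> and item \<open>j\<close> with weight \<open>Q\<close>. The front position is
  examined equally in both by A2, and by A4 the rear position is examined more when the less
  attractive item is in front; so \<open>Q <= P\<close> and \<open>weighted_difference_ge\<close>
  applies.\<close>

lemma exchange_drift:
  assumes R: "R \<in> lists_K K" and p: "p \<in> {1..<K}" and ij: "R p = i" "R (Suc p) = j" "i < j"
  defines "R' \<equiv> swap_pos R p (Suc p)"
  defines "v \<equiv> (chi R p * alpha i - chi R (Suc p) * alpha j) + (chi R' (Suc p) * alpha i - chi R' p * alpha j)"
    and "u \<equiv> (chi R p * alpha i + chi R (Suc p) * alpha j) + (chi R' (Suc p) * alpha i + chi R' p * alpha j)"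
  shows "2 * chi_min * (alpha i - alpha j) \<le> v" "(alpha i - alpha j) * u \<le> v * (alpha i + alpha j)"
proof -
  have R': "R' \<in> lists_K K" unfolding R'_def using R p by (intro swap_pos_lists_K) auto
  have i: "i \<in> {1..K}" and j: "j \<in> {1..K}" using lists_K_in[OF R, of p] lists_K_in[OF R, of "Suc p"] p ij by auto
  have lt: "alpha j < alpha i" using alpha_strict[of i j] i j ij(3) by simp
  have "R ` {1..<p} = R' ` {1..<p}" unfolding R'_def
    by (intro image_cong refl) (auto simp: swap_pos_apply)
  then have eq: "chi R p = chi R' p" using A2[rule_format, OF R R', of p] p by simp
  have "\<not> chi R (Suc p) \<ge> chi R' (Suc p)"
    using A4[rule_format, OF R R', of p "Suc p"] p lt ij by (simp add: R'_def)
  then have le: "chi R p + chi R (Suc p) \<le> chi R p + chi R' (Suc p)" by simp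
  define P Q where "P = chi R p + chi R' (Suc p)" "Q = chi R p + chi R (Suc p)"
  have v: "v = P * alpha i - Q * alpha j" and u: "u = P * alpha i + Q * alpha j"
    unfolding v_def u_def P_Q_def eq by (simp_all add: algebra_simps)
  have "2 * chi_min \<le> P" unfolding P_Q_def
    using chi_ge_min[OF R, of p] chi_ge_min[OF R', of "Suc p"] p by simp
  then have "2 * chi_min * (alpha i - alpha j) \<le> P * (alpha i - alpha j)"
    using lt by (intro mult_right_mono) auto
  also have "\<dots> \<le> v" unfolding v P_Q_def
    using le lt alpha_bounds by (intro weighted_difference_ge(1)) auto
  finally show "2 * chi_min * (alpha i - alpha j) \<le> v" .
  show "(alpha i - alpha j) * u \<le> v * (alpha i + alpha j)"
    unfolding u v using le lt alpha_bounds unfolding P_Q_def by (intro weighted_difference_ge(2)) auto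
qed

lemma pair_drift:
  assumes Rb: "Rb \<in> lists_K K" and good: "good \<delta> K s m" and p: "p \<in> acts K t"
    and ij: "(i, j) = adj_pair Rb p"
  defines "E \<equiv> measure_pmf.expectation (outcomes t s m Rb)"
  shows "chi_min * (alpha i - alpha j) \<le> E (\<lambda>w. real_of_int (incr (fst w) (snd w) p i j))"
    and "(alpha i - alpha j) * E (\<lambda>w. \<bar>real_of_int (incr (fst w) (snd w) p i j)\<bar>)
       \<le> E (\<lambda>w. real_of_int (incr (fst w) (snd w) p i j)) * (alpha i + alpha j)"
proof -
  let ?D = "display K \<delta> t s m Rb"
  have pK: "p \<in> {1..<K}" using p by (auto simp: acts_def)
  have Rbp: "Rb p \<in> {1..K}" "Rb (Suc p) \<in> {1..K}" "Rb p \<noteq> Rb (Suc p)"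
    using lists_K_in[OF Rb, of p] lists_K_in[OF Rb, of "Suc p"] pK lists_K_inj[OF Rb]
    by (auto simp: inj_eq)
  have ij': "i < j" "i \<in> {1..K}" "j \<in> {1..K}" "{Rb p, Rb (Suc p)} = {i, j}"
    using ij Rbp by (auto simp: adj_pair_def min_def max_def)
  have lt: "alpha j < alpha i" using ij' alpha_strict[of i j] by simp
  \<comment> \<open>The positions of \<open>i\<close> and \<open>j\<close> in the displayed list
    \<open>R\<close>.\<close>
  define x y where "x R = (if R p = i then p else Suc p)" and "y R = (if R p = i then Suc p else p)" for R :: rlist
  define v u where "v R = chi R (x R) * alpha i - chi R (y R) * alpha j"
    and "u R = chi R (x R) * alpha i + chi R (y R) * alpha j" for R
  have supp: "R (x R) = i" "R (y R) = j" "{x R, y R} = {p, Suc p}" "R \<in> lists_K K" if "R \<in> set_pmf ?D" for R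
    using display_support(1)[OF that p] ij' display_lists_K[OF Rb that]
    by (auto simp: x_def y_def doubleton_eq_iff)
  have fin: "finite (set_pmf ?D)" by (rule finite_display[OF Rb])
  note int = integrable_measure_pmf_finite[OF fin]
  have Ev: "E (\<lambda>w. real_of_int (incr (fst w) (snd w) p i j)) = measure_pmf.expectation ?D v"
    unfolding E_def expectation_outcomes[OF Rb] v_def
    using supp ij'(1) pK by (intro expectation_cong_pmf expectation_incr(1)) auto
  have Eu: "E (\<lambda>w. \<bar>real_of_int (incr (fst w) (snd w) p i j)\<bar>) \<le> measure_pmf.expectation ?D u"
    unfolding E_def expectation_outcomes[OF Rb] u_def
    using supp ij'(1) pK by (intro expectation_mono_finite expectation_incr(2) fin) auto
  have main: "chi_min * (alpha i - alpha j) \<le> measure_pmf.expectation ?D v \<and>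
     (alpha i - alpha j) * measure_pmf.expectation ?D u \<le> measure_pmf.expectation ?D v * (alpha i + alpha j)"
  proof (cases "unsure \<delta> s m p Rb")
    case True
    let ?sw = "\<lambda>R. swap_pos R p (Suc p)"
    \<comment> \<open>The displayed list has the same law as its exchange at \<open>p\<close>, so
      any expectation equals that of the average over both orders.\<close>
    have sym: "measure_pmf.expectation ?D f = measure_pmf.expectation ?D (\<lambda>R. (f R + f (?sw R)) / 2)"
      for f :: "rlist \<Rightarrow> real"
    proof -
      have "measure_pmf.expectation ?D (\<lambda>R. f (?sw R)) = measure_pmf.expectation (map_pmf ?sw ?D) f"
        by simp
      also have "\<dots> = measure_pmf.expectation ?D f"
        using display_swap_invariant[OF p True] by simp
      finally show ?thesis by (simp add: int)
    qed
    have pt: "2 * chi_min * (alpha i - alpha j) \<le> v R + v (?sw R) \<and>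
        (alpha i - alpha j) * (u R + u (?sw R)) \<le> (v R + v (?sw R)) * (alpha i + alpha j)"
      if "R \<in> set_pmf ?D" for R
    proof (cases "R p = i")
      case True
      then show ?thesis
        using exchange_drift[OF supp(4)[OF that] pK, of i j] supp[OF that] ij'(1)
        by (simp add: v_def u_def x_def y_def swap_pos_apply)
    next
      case False
      have RK: "?sw R \<in> lists_K K" using supp(4)[OF that] pK by (intro swap_pos_lists_K) auto
      have "R (Suc p) = i" "R p = j" using supp[OF that] False by (auto simp: x_def y_def)
      then show ?thesis
        using exchange_drift[OF RK pK, of i j] ij'(1)
        by (simp add: v_def u_def x_def y_def swap_pos_apply add.commute)
    qed
    have "measure_pmf.expectation ?D (\<lambda>_. chi_min * (alpha i - alpha j))
        \<le> measure_pmf.expectation ?D (\<lambda>R. (v R + v (?sw R)) / 2)"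
      using pt by (intro expectation_mono_finite fin) (simp add: field_simps)
    moreover have "measure_pmf.expectation ?D (\<lambda>R. (alpha i - alpha j) * ((u R + u (?sw R)) / 2))
        \<le> measure_pmf.expectation ?D (\<lambda>R. ((v R + v (?sw R)) / 2) * (alpha i + alpha j))"
    proof (intro expectation_mono_finite fin)
      fix R assume "R \<in> set_pmf ?D"
      from pt[OF this] show "(alpha i - alpha j) * ((u R + u (?sw R)) / 2)
          \<le> ((v R + v (?sw R)) / 2) * (alpha i + alpha j)"
        by (simp only: times_divide_eq_left times_divide_eq_right) simp
    qed
    ultimately show ?thesis unfolding sym[of v] sym[of u] by simp
  next
    case False
    \<comment> \<open>A pair that is not randomised is believed with confidence to be in its present
      order, and \<open>good\<close> rules this out for an inversion.\<close>
    have "\<not> Rb (Suc p) < Rb p"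
      using False good Rbp unfolding good_def unsure_def by auto
    then have ijp: "i = Rb p" "j = Rb (Suc p)" using Rbp(3) ij by (auto simp: adj_pair_def)
    have pt: "chi_min * (alpha i - alpha j) \<le> v R \<and> (alpha i - alpha j) * u R \<le> v R * (alpha i + alpha j)"
      if "R \<in> set_pmf ?D" for R
    proof -
      have "R p = i" using display_support(1)[OF that p] False ijp by auto
      then have xy: "x R = p" "y R = Suc p" by (auto simp: x_def y_def)
      have le: "chi R (Suc p) \<le> chi R p" using chi_decreasing[OF supp(4)[OF that], of p "Suc p"] pK by simp
      have "chi_min * (alpha i - alpha j) \<le> chi R p * (alpha i - alpha j)"
        using lt chi_ge_min[OF supp(4)[OF that], of p] pK by (intro mult_right_mono) auto
      also have "\<dots> \<le> v R" unfolding v_def xy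
        using lt alpha_bounds by (intro weighted_difference_ge(1) le) auto
      finally have "chi_min * (alpha i - alpha j) \<le> v R" .
      moreover have "(alpha i - alpha j) * u R \<le> v R * (alpha i + alpha j)"
        unfolding v_def u_def xy using lt alpha_bounds by (intro weighted_difference_ge(2) le) auto
      ultimately show ?thesis ..
    qed
    have "measure_pmf.expectation ?D (\<lambda>_. chi_min * (alpha i - alpha j)) \<le> measure_pmf.expectation ?D v"
      using pt by (intro expectation_mono_finite fin) simp
    moreover have "measure_pmf.expectation ?D (\<lambda>R. (alpha i - alpha j) * u R)
        \<le> measure_pmf.expectation ?D (\<lambda>R. v R * (alpha i + alpha j))"
      using pt by (intro expectation_mono_finite fin) simp
    ultimately show ?thesis by simp
  qed
  show "chi_min * (alpha i - alpha j) \<le> E (\<lambda>w. real_of_int (incr (fst w) (snd w) p i j))"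
    using main Ev by simp
  have "(alpha i - alpha j) * E (\<lambda>w. \<bar>real_of_int (incr (fst w) (snd w) p i j)\<bar>)
      \<le> (alpha i - alpha j) * measure_pmf.expectation ?D u"
    using Eu lt by (intro mult_left_mono) auto
  then show "(alpha i - alpha j) * E (\<lambda>w. \<bar>real_of_int (incr (fst w) (snd w) p i j)\<bar>)
       \<le> E (\<lambda>w. real_of_int (incr (fst w) (snd w) p i j)) * (alpha i + alpha j)"
    using main Ev by simp
qed

end

lemma adj_pair_set: "(i, j) = adj_pair R p \<Longrightarrow> {i, j} = {R p, R (Suc p)}"
  by (auto simp: adj_pair_def min_def max_def)

lemma inj_on_adj_pair:
  assumes "inj R"
  shows "inj_on (adj_pair R) A"
proof (rule inj_onI)
  fix p q assume "adj_pair R p = adj_pair R q"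
  then have "{R p, R (Suc p)} = {R q, R (Suc q)}"
    using adj_pair_set[of _ _ R p] adj_pair_set[of _ _ R q] by (metis surj_pair)
  then have "R ` {p, Suc p} = R ` {q, Suc q}" by simp
  then have "{p, Suc p} = {q, Suc q}" by (simp only: inj_image_eq_iff[OF assms])
  then show "p = q" by (auto simp: doubleton_eq_iff)
qed

lemma adj_pair_range:
  assumes R: "R \<in> lists_K K" and p: "p \<in> {1..<K}" and ij: "(i, j) = adj_pair R p"
  shows "1 \<le> i" "i < j" "j \<le> K"
proof -
  have "R p \<in> {1..K}" "R (Suc p) \<in> {1..K}" 
    by (rule lists_K_in[OF R], use p in simp)+
  moreover have "R p \<noteq> R (Suc p)" using lists_K_inj[OF R] by (simp add: inj_eq)
  ultimately show "1 \<le> i" "i < j" "j \<le> K" using ij by (auto simp: adj_pair_def)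
qed

context bubble_rank
begin

section \<open>Pair potentials of the click model and reachable states\<close>

definition M :: real where "M = real K * chi_max"

definition gamma :: "nat \<Rightarrow> nat \<Rightarrow> real" where
  "gamma i j = (alpha i - alpha j) / (alpha i + alpha j)"

text \<open>Scaled such that a drift of \<open>chi_min * (alpha i - alpha j)\<close> pays
  \<open>2 * M * (alpha i - alpha j)\<close>: one half for the regret of the round, the other for
  the cost deferred from the round before.\<close>

definition psi :: "nat \<Rightarrow> nat \<Rightarrow> int \<Rightarrow> nat \<Rightarrow> real" where
  "psi i j a b = 2 * M / chi_min * pair_pot (gamma i j) L a b"

text \<open>Bounds the value of \<open>psi\<close> for a pair never compared. The bracket is
  \<open>4 * (16 * L + 42)\<close>: one factor 2 comes from \<open>psi\<close>, the other from
  \<open>alpha i + alpha j <= 2\<close>.\<close>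

definition C :: real where
  "C = M / (chi_min * gap_min) * (64 * L + 168)"

text \<open>Invariants of the states after \<open>t\<close> rounds. The bound of \<open>s\<close> by
  \<open>m\<close> forces \<open>s i j = 0\<close> for pairs never compared, and
  \<open>m i j <= t\<close> limits the numbers of comparisons that \<open>deviation\<close> has to
  cover.\<close>

definition valid :: "nat \<Rightarrow> (nat \<Rightarrow> nat \<Rightarrow> int) \<Rightarrow> (nat \<Rightarrow> nat \<Rightarrow> nat) \<Rightarrow> rlist \<Rightarrow> bool" where
  "valid t s m R \<longleftrightarrow> R \<in> lists_K K \<and> (\<forall>i j. s j i = - s i j) \<and> (\<forall>i j. m j i = m i j)
     \<and> (\<forall>i j. \<bar>s i j\<bar> \<le> int (m i j)) \<and> (\<forall>i j. m i j \<le> t)"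

lemma L_pos: "L > 0"
  unfolding L_def using delta by simp

lemma M_pos: "M > 0"
  unfolding M_def using chi_max_pos K_ge_2 by simp

lemma gamma_bounds:
  assumes "1 \<le> i" "i < j" "j \<le> K"
  shows "0 < gamma i j" "gamma i j \<le> 1"
  using alpha_strict[OF assms] alpha_pos[of j] alpha_pos[of i] assms unfolding gamma_def by auto

lemma psi_nonneg: "1 \<le> i \<Longrightarrow> i < j \<Longrightarrow> j \<le> K \<Longrightarrow> psi i j a b \<ge> 0"
  unfolding psi_def using pair_pot_nonneg[OF gamma_bounds(1)] M_pos chi_min_pos by simp

lemma psi_zero_le:
  assumes "1 \<le> i" "i < j" "j \<le> K"
  shows "psi i j 0 0 \<le> C"
proof -
  note g = gamma_bounds[OF assms]
  have sum2: "alpha i + alpha j \<le> 2" using alpha_bounds(2)[of i] alpha_bounds(2)[of j] by simp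
  have gap: "gap_min \<le> alpha i - alpha j" using assms by (rule alpha_gap)
  have "1 / gamma i j \<le> 2 / gap_min"
    unfolding gamma_def using frac_le[of "2" "alpha i + alpha j" gap_min "alpha i - alpha j"] sum2 gap gap_min_pos by simp
  then have "(16 * L + 42) * (1 / gamma i j) \<le> (16 * L + 42) * (2 / gap_min)"
    using L_pos by (intro mult_left_mono) auto
  then have "pair_pot (gamma i j) L 0 0 \<le> (16 * L + 42) * (2 / gap_min)"
    using pair_pot_zero_le[OF g L_pos] by simp
  then have "psi i j 0 0 \<le> 2 * M / chi_min * ((16 * L + 42) * (2 / gap_min))"
    unfolding psi_def using M_pos chi_min_pos by (intro mult_left_mono) auto
  also have "\<dots> = C" unfolding C_def using gap_min_pos chi_min_pos by (simp add: field_simps)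
  finally show ?thesis .
qed

section \<open>Evolution of the statistics in one round\<close>

abbreviation stats' :: "nat \<Rightarrow> (nat \<Rightarrow> nat \<Rightarrow> int) \<Rightarrow> (nat \<Rightarrow> nat \<Rightarrow> nat) \<Rightarrow> rlist \<times> (nat \<Rightarrow> bool)
    \<Rightarrow> (nat \<Rightarrow> nat \<Rightarrow> int) \<times> (nat \<Rightarrow> nat \<Rightarrow> nat)" where
  "stats' t s m w \<equiv> upd_stats K t (fst w) (snd w) (s, m)"

lemma display_pair_set:
  assumes "R \<in> set_pmf (display K \<delta> t s m Rb)" "p \<in> acts K t"
  shows "{R p, R (Suc p)} = {Rb p, Rb (Suc p)}"
  using display_support(1)[OF assms] by auto

lemma stats_active:
  assumes "Rb \<in> lists_K K" "w \<in> set_pmf (outcomes t s m Rb)" "p \<in> acts K t" "(i, j) = adj_pair Rb p"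
  shows "fst (stats' t s m w) i j = s i j + incr (fst w) (snd w) p i j"
    and "snd (stats' t s m w) i j = m i j + nat \<bar>incr (fst w) (snd w) p i j\<bar>"
proof -
  note w = outcomes_support[OF assms(1,2)]
  have "{i, j} = {fst w p, fst w (Suc p)}"
    using adj_pair_set[OF assms(4)] display_pair_set[OF w(1) assms(3)] by simp
  from sum_incr_active[OF w(3) assms(3) this]
  show "fst (stats' t s m w) i j = s i j + incr (fst w) (snd w) p i j"
    "snd (stats' t s m w) i j = m i j + nat \<bar>incr (fst w) (snd w) p i j\<bar>"
    by (simp_all add: upd_stats_eq[OF w(3)])
qed

lemma stats_inactive:
  assumes "Rb \<in> lists_K K" "w \<in> set_pmf (outcomes t s m Rb)" "i < j" "(i, j) \<notin> adj_pair Rb ` acts K t"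
  shows "fst (stats' t s m w) i j = s i j" and "snd (stats' t s m w) i j = m i j"
proof -
  note w = outcomes_support[OF assms(1,2)]
  have "{i, j} \<noteq> {fst w p, fst w (Suc p)}" if "p \<in> acts K t" for p
  proof
    assume "{i, j} = {fst w p, fst w (Suc p)}"
    then have "{i, j} = {Rb p, Rb (Suc p)}" using display_pair_set[OF w(1) that] by simp
    then have "(i, j) = adj_pair Rb p" using assms(3) by (auto simp: adj_pair_def doubleton_eq_iff)
    then show False using assms(4) that by auto
  qed
  from sum_incr_inactive[of K t i j "fst w", OF this]
  show "fst (stats' t s m w) i j = s i j" "snd (stats' t s m w) i j = m i j"
    by (simp_all add: upd_stats_eq[OF w(3)])
qed

lemma valid_step:
  assumes "valid t s m Rb" "w \<in> set_pmf (outcomes t' s m Rb)"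
  defines "s' \<equiv> fst (stats' t' s m w)" and "m' \<equiv> snd (stats' t' s m w)"
  shows "valid (Suc t) s' m' (upd_base K \<delta> s' m' Rb)"
proof -
  have Rb: "Rb \<in> lists_K K" using assms(1) unfolding valid_def by blast
  note w = outcomes_support[OF Rb assms(2)]
  have s': "s' x y = s x y + (\<Sum>p\<in>acts K t'. incr (fst w) (snd w) p x y)"
    and m': "m' x y = m x y + (\<Sum>p\<in>acts K t'. nat \<bar>incr (fst w) (snd w) p x y\<bar>)" for x y
    unfolding s'_def m'_def by (simp_all add: upd_stats_eq[OF w(3)])
  have anti: "s' j i = - s' i j" and sym: "m' j i = m' i j" for i j
  proof -
    have "s j i = - s i j" "m j i = m i j" using assms(1) unfolding valid_def by blast+
    then show "s' j i = - s' i j" "m' j i = m' i j"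
      unfolding s' m' incr_antisym[of "fst w" "snd w" _ j i] by (simp_all add: sum_negf)
  qed
  have bound: "\<bar>s' i j\<bar> \<le> int (m' i j)" for i j
  proof -
    have b: "\<bar>s i j\<bar> \<le> int (m i j)" using assms(1) unfolding valid_def by blast
    have "\<bar>s' i j\<bar> \<le> \<bar>s i j\<bar> + \<bar>\<Sum>p\<in>acts K t'. incr (fst w) (snd w) p i j\<bar>" unfolding s' by linarith
    also have "\<dots> \<le> int (m i j) + (\<Sum>p\<in>acts K t'. \<bar>incr (fst w) (snd w) p i j\<bar>)"
      by (intro add_mono sum_abs b)
    also have "\<dots> = int (m' i j)" unfolding m' by simp
    finally show ?thesis .
  qed
  have time: "m' i j \<le> Suc t" for i j
  proof -
    have "(\<Sum>p\<in>acts K t'. nat \<bar>incr (fst w) (snd w) p i j\<bar>) \<le> 1"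
    proof (cases "\<exists>p\<in>acts K t'. {i, j} = {fst w p, fst w (Suc p)}")
      case True
      then obtain p where p: "p \<in> acts K t'" "{i, j} = {fst w p, fst w (Suc p)}" by auto
      show ?thesis unfolding sum_incr_active(2)[OF w(3) p]
        using incr_values[of "fst w" "snd w" p i j] by auto
    next
      case False
      then show ?thesis by (subst sum_incr_inactive(2)) auto
    qed
    moreover have "m i j \<le> t" using assms(1) unfolding valid_def by blast
    ultimately show ?thesis unfolding m' by linarith
  qed
  show ?thesis unfolding valid_def
    using anti sym bound time upd_base_lists_K[OF Rb] by blast
qed

text \<open>In the expectation of \<open>pair_pot_step\<close>, the second part of
  \<open>pair_drift\<close> makes the \<open>c1\<close> term nonpositive and the first part bounds
  the mean step from below.\<close>

lemma psi_expected_step: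
  assumes Rb: "Rb \<in> lists_K K" and good: "good \<delta> K s m" and p: "p \<in> acts K t"
    and ij: "(i, j) = adj_pair Rb p"
  shows "measure_pmf.expectation (outcomes t s m Rb)
       (\<lambda>w. psi i j (fst (stats' t s m w) i j) (snd (stats' t s m w) i j))
     \<le> psi i j (s i j) (m i j)
        - (if real_of_int (s i j) \<le> thr \<delta> (m i j) then 2 * M * (alpha i - alpha j) else 0)"
proof -
  let ?E = "measure_pmf.expectation (outcomes t s m Rb)"
  let ?x = "\<lambda>w. incr (fst w) (snd w) p i j"
  have pK: "p \<in> {1..<K}" using p by (auto simp: acts_def)
  note ij' = adj_pair_range[OF Rb pK ij]
  note g = gamma_bounds[OF ij']
  have lt: "alpha j < alpha i" using alpha_strict[OF ij'] .
  obtain c1 c2 where c: "c1 \<ge> 0" "c2 \<ge> 0"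
    "real_of_int (s i j) \<le> 2 * sqrt (real (m i j) * L) \<Longrightarrow> c2 \<ge> 1"
    "\<And>x. x \<in> {-1, 0, 1} \<Longrightarrow>
       pair_pot (gamma i j) L (s i j + x) (m i j + nat \<bar>x\<bar>)
         \<le> pair_pot (gamma i j) L (s i j) (m i j) + c1 * (gamma i j * \<bar>x\<bar> - x) - c2 * real_of_int x"
    using pair_pot_step[OF g L_pos] by blast
  have fin: "finite (set_pmf (outcomes t s m Rb))" by (rule finite_outcomes[OF Rb])
  note int = integrable_measure_pmf_finite[OF fin]
  note dr = pair_drift[OF Rb good p ij]
  have sum_pos: "alpha i + alpha j > 0" using alpha_pos[of j] ij' alpha_bounds(1)[of i] by simp
  have dr2: "gamma i j * ?E (\<lambda>w. \<bar>real_of_int (?x w)\<bar>) \<le> ?E (\<lambda>w. real_of_int (?x w))"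
    using dr(2) sum_pos unfolding gamma_def by (simp add: field_simps)
  have "?E (\<lambda>w. pair_pot (gamma i j) L (fst (stats' t s m w) i j) (snd (stats' t s m w) i j))
     \<le> ?E (\<lambda>w. pair_pot (gamma i j) L (s i j) (m i j)
           + c1 * (gamma i j * \<bar>real_of_int (?x w)\<bar> - real_of_int (?x w)) - c2 * real_of_int (?x w))"
    using c(4)[OF incr_values] by (intro expectation_mono_finite fin) (simp add: stats_active[OF Rb _ p ij])
  also have "\<dots> = pair_pot (gamma i j) L (s i j) (m i j)
           + c1 * (gamma i j * ?E (\<lambda>w. \<bar>real_of_int (?x w)\<bar>) - ?E (\<lambda>w. real_of_int (?x w)))
           - c2 * ?E (\<lambda>w. real_of_int (?x w))"
    by (simp add: int)
  also have "\<dots> \<le> pair_pot (gamma i j) L (s i j) (m i j) - c2 * (chi_min * (alpha i - alpha j))"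
    using mult_left_mono[OF dr(1) c(2)] mult_nonneg_nonpos[OF c(1), of "gamma i j * ?E (\<lambda>w. \<bar>real_of_int (?x w)\<bar>) - ?E (\<lambda>w. real_of_int (?x w))"] dr2
    by linarith
  finally have main: "?E (\<lambda>w. pair_pot (gamma i j) L (fst (stats' t s m w) i j) (snd (stats' t s m w) i j))
     \<le> pair_pot (gamma i j) L (s i j) (m i j) - c2 * (chi_min * (alpha i - alpha j))" .
  have "?E (\<lambda>w. psi i j (fst (stats' t s m w) i j) (snd (stats' t s m w) i j))
      = 2 * M / chi_min * ?E (\<lambda>w. pair_pot (gamma i j) L (fst (stats' t s m w) i j) (snd (stats' t s m w) i j))"
    unfolding psi_def by simp
  also have "\<dots> \<le> 2 * M / chi_min * (pair_pot (gamma i j) L (s i j) (m i j) - c2 * (chi_min * (alpha i - alpha j)))"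
    using main M_pos chi_min_pos by (intro mult_left_mono) auto
  also have "\<dots> = psi i j (s i j) (m i j) - c2 * (2 * M * (alpha i - alpha j))"
    unfolding psi_def using chi_min_pos by (simp add: field_simps)
  also have "\<dots> \<le> psi i j (s i j) (m i j)
      - (if real_of_int (s i j) \<le> thr \<delta> (m i j) then 2 * M * (alpha i - alpha j) else 0)"
  proof -
    have "0 \<le> 2 * M * (alpha i - alpha j)" using M_pos lt by simp
    then have "(if real_of_int (s i j) \<le> thr \<delta> (m i j) then 2 * M * (alpha i - alpha j) else 0)
        \<le> c2 * (2 * M * (alpha i - alpha j))"
      using c(2,3) mult_right_mono[of 1 c2 "2 * M * (alpha i - alpha j)"] by (simp add: thr_def L_def)
    then show ?thesis by simp
  qed
  finally show ?thesis .
qed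

section \<open>Supermartingales that control wrong beliefs\<close>

definition deviation :: "nat \<Rightarrow> int \<Rightarrow> nat \<Rightarrow> real" where
  "deviation n a b = \<delta> * (\<Sum>k=1..n. exp (- sqrt (L / real k) * real_of_int a - L / real k * real b))"

lemma deviation_nonneg: "deviation n a b \<ge> 0"
  unfolding deviation_def using delta by (intro mult_nonneg_nonneg sum_nonneg) auto

lemma deviation_zero: "deviation n 0 0 = \<delta> * n"
  by (simp add: deviation_def)

text \<open>In the summand \<open>k = b\<close> the two exponents are at least \<open>2 * L\<close>
  and exactly \<open>- L\<close>, so it is at least \<open>exp L = 1 / \<delta>\<close>, which
  cancels the factor \<delta>; the other summands are positive.\<close>

lemma deviation_ge_1:
  assumes "real_of_int (- a) > thr \<delta> b" "1 \<le> b" "b \<le> n"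
  shows "deviation n a b \<ge> 1"
proof -
  have e: "exp (- sqrt (L / b) * real_of_int a - L / b * real b) \<ge> 1 / \<delta>"
  proof -
    have "sqrt (L / b) * (2 * sqrt (real b * L)) \<le> sqrt (L / b) * (- real_of_int a)"
      using assms(1) L_pos by (intro mult_left_mono) (auto simp: thr_def L_def)
    moreover have "sqrt (L / b) * sqrt (real b * L) = L"
      using assms(2) L_pos by (simp flip: real_sqrt_mult)
    ultimately have "L \<le> - sqrt (L / b) * real_of_int a - L / b * real b" using assms(2) by simp
    moreover have "exp L = 1 / \<delta>" unfolding L_def using delta by simp
    ultimately show ?thesis by (metis exp_le_cancel_iff)
  qed
  also have "exp (- sqrt (L / b) * real_of_int a - L / b * real b)
      \<le> (\<Sum>k=1..n. exp (- sqrt (L / real k) * real_of_int a - L / real k * real b))"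
    using assms(2,3) by (intro member_le_sum[of b "{1..n}" "\<lambda>k. exp (- sqrt (L / k) * real_of_int a - L / k * real b)"]) auto
  finally show ?thesis unfolding deviation_def using delta by (simp add: field_simps)
qed

text \<open>By \<open>exp_walk_step\<close> each summand is multiplied in expectation by at most
  \<open>1 - \<mu> * h\<close>, where the mean step \<open>\<mu>\<close> is nonnegative by
  \<open>pair_drift\<close> and \<open>h\<close> is nonnegative.\<close>

lemma deviation_expected_step:
  assumes Rb: "Rb \<in> lists_K K" and good: "good \<delta> K s m" and p: "p \<in> acts K t"
    and ij: "(i, j) = adj_pair Rb p"
  shows "measure_pmf.expectation (outcomes t s m Rb)
       (\<lambda>w. deviation n (fst (stats' t s m w) i j) (snd (stats' t s m w) i j))
     \<le> deviation n (s i j) (m i j)"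
proof -
  let ?E = "measure_pmf.expectation (outcomes t s m Rb)"
  let ?x = "\<lambda>w. incr (fst w) (snd w) p i j"
  have fin: "finite (set_pmf (outcomes t s m Rb))" by (rule finite_outcomes[OF Rb])
  note int = integrable_measure_pmf_finite[OF fin]
  have pK: "p \<in> {1..<K}" using p by (auto simp: acts_def)
  note ij' = adj_pair_range[OF Rb pK ij]
  have Ex: "?E (\<lambda>w. real_of_int (?x w)) \<ge> 0"
    using pair_drift(1)[OF Rb good p ij] alpha_strict[OF ij'] chi_min_pos
    by (smt (verit) mult_nonneg_nonneg)
  have k: "?E (\<lambda>w. exp (- sqrt (L / k) * real_of_int (fst (stats' t s m w) i j)
        - L / k * real (snd (stats' t s m w) i j)))
      \<le> exp (- sqrt (L / k) * real_of_int (s i j) - L / k * real (m i j))" (is "_ \<le> ?e") for k :: nat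
  proof -
    define l where "l = sqrt (L / k)"
    have l: "l \<ge> 0" "L / k = l\<^sup>2" unfolding l_def using L_pos by auto
    define h where "h = sinh l * exp (- l\<^sup>2)"
    have h: "h \<ge> 0" unfolding h_def using l by simp
    have "?E (\<lambda>w. exp (- sqrt (L / k) * real_of_int (fst (stats' t s m w) i j)
        - L / k * real (snd (stats' t s m w) i j))) \<le> ?E (\<lambda>w. ?e * (1 - real_of_int (?x w) * h))"
    proof (intro expectation_mono_finite fin)
      fix w assume w: "w \<in> set_pmf (outcomes t s m Rb)"
      have "exp (- l * real_of_int (fst (stats' t s m w) i j) - l\<^sup>2 * real (snd (stats' t s m w) i j))
          = exp (- l * real_of_int (s i j) - l\<^sup>2 * real (m i j)) * exp (- l * ?x w - l\<^sup>2 * \<bar>?x w\<bar>)"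
        unfolding stats_active[OF Rb w p ij] by (simp add: algebra_simps flip: exp_add)
      also have "\<dots> \<le> exp (- l * real_of_int (s i j) - l\<^sup>2 * real (m i j)) * (1 - ?x w * h)"
        unfolding h_def by (intro mult_left_mono exp_walk_step incr_values) auto
      finally show "exp (- sqrt (L / k) * real_of_int (fst (stats' t s m w) i j)
        - L / k * real (snd (stats' t s m w) i j)) \<le> ?e * (1 - real_of_int (?x w) * h)"
        unfolding l_def[symmetric] unfolding l(2) .
    qed
    also have "\<dots> = ?e * (1 - ?E (\<lambda>w. real_of_int (?x w)) * h)" by (simp add: int)
    also have "\<dots> \<le> ?e * 1" using Ex h by (intro mult_left_mono) auto
    finally show ?thesis by simp
  qed
  have "?E (\<lambda>w. deviation n (fst (stats' t s m w) i j) (snd (stats' t s m w) i j))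
     = \<delta> * (\<Sum>k=1..n. ?E (\<lambda>w. exp (- sqrt (L / k) * real_of_int (fst (stats' t s m w) i j)
        - L / k * real (snd (stats' t s m w) i j))))"
    unfolding deviation_def by (simp add: int Bochner_Integration.integral_sum)
  also have "\<dots> \<le> deviation n (s i j) (m i j)"
    unfolding deviation_def using delta k by (intro mult_left_mono sum_mono) auto
  finally show ?thesis .
qed

end

section \<open>Regret of a round\<close>

text \<open>Pigeonhole: the \<open>k\<close> best items do not all fit into the \<open>k - 1\<close>
  positions before \<open>k\<close>.\<close>

lemma exists_later_better:
  assumes R: "R \<in> lists_K K" and k: "k \<in> {1..K}"
  shows "\<exists>k'\<in>{k..K}. R k' \<in> {1..k}"
proof (rule ccontr)
  assume no: "\<not> (\<exists>k'\<in>{k..K}. R k' \<in> {1..k})"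
  have p: "R permutes {1..K}" using R by (simp add: lists_K_def)
  have "inv R ` {1..k} \<subseteq> {1..<k}"
  proof
    fix q assume "q \<in> inv R ` {1..k}"
    then obtain i where i: "i \<in> {1..k}" "q = inv R i" by auto
    have "R q = i" using i(2) permutes_inverses(1)[OF p] by simp
    moreover have "q \<in> {1..K}"
      using i k permutes_in_image[OF permutes_inv[OF p], of i] by auto
    ultimately show "q \<in> {1..<k}" using no i(1) by force
  qed
  then have "card (inv R ` {1..k}) \<le> k - 1" using card_mono[of "{1..<k}"] by fastforce
  moreover have "card (inv R ` {1..k}) = k"
    using permutes_inj_on[OF permutes_inv[OF p]] by (simp add: card_image)
  ultimately have "k \<le> k - 1" by simp
  moreover have "1 \<le> k" using k by simp
  ultimately show False by linarith
qed

context bubble_rank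
begin

definition viol_sum :: "nat \<Rightarrow> rlist \<Rightarrow> real" where
  "viol_sum t R = (\<Sum>p\<in>acts K t. viol alpha R p)"

definition unsure_gap :: "nat \<Rightarrow> (nat \<Rightarrow> nat \<Rightarrow> int) \<Rightarrow> (nat \<Rightarrow> nat \<Rightarrow> nat) \<Rightarrow> rlist \<Rightarrow> real" where
  "unsure_gap t s m R =
     (\<Sum>p\<in>acts K t. if unsure \<delta> s m p R then \<bar>alpha (R p) - alpha (R (Suc p))\<bar> else 0)"

lemma viol_nonneg: "viol \<alpha> R p \<ge> 0"
  by (simp add: viol_def)

lemma viol_sum_nonneg: "viol_sum t R \<ge> 0"
  unfolding viol_sum_def by (intro sum_nonneg viol_nonneg)

lemma inversion_of_viol:
  assumes R: "R \<in> lists_K K" and p: "p \<in> {1..<K}" and v: "viol alpha R p > 0"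
  shows "R (Suc p) < R p"
proof (rule ccontr)
  assume "\<not> R (Suc p) < R p"
  moreover have "R p \<in> {1..K}" "R (Suc p) \<in> {1..K}" by (rule lists_K_in[OF R], use p in simp)+
  ultimately have "alpha (R (Suc p)) \<le> alpha (R p)" by (intro alpha_antimono) auto
  then show False using v by (simp add: viol_def)
qed

text \<open>Each violated neighbour pair is an inversion of its own and contributes at most 1. This
  keeps the potential nonnegative although \<open>viol_sum\<close> enters it with a negative
  sign.\<close>

lemma viol_sum_le_badpairs:
  assumes R: "R \<in> lists_K K"
  shows "viol_sum t R \<le> card (badpairs K R)"
proof -
  let ?S = "{p \<in> acts K t. R (Suc p) < R p}"
  have "viol alpha R p \<le> of_bool (R (Suc p) < R p)" if "p \<in> acts K t" for p
  proof -
    have p: "p \<in> {1..<K}" using that by (auto simp: acts_def)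
    show ?thesis
    proof (cases "R (Suc p) < R p")
      case True
      then show ?thesis using viol_bounds(2)[where \<alpha> = alpha, OF R _ p] alpha_bounds by simp
    next
      case False
      then have "\<not> viol alpha R p > 0" using inversion_of_viol[OF R p] by blast
      then show ?thesis using False by simp
    qed
  qed
  then have "viol_sum t R \<le> (\<Sum>p\<in>acts K t. of_bool (R (Suc p) < R p))"
    unfolding viol_sum_def by (rule sum_mono)
  also have "\<dots> = real (card ?S)" by (simp add: sum_of_bool_eq Collect_conj_eq)
  also have "card ?S = card ((\<lambda>p. (R (Suc p), R p)) ` ?S)"
    using lists_K_inj[OF R] by (intro card_image[symmetric] inj_onI) (simp add: inj_eq)
  also have "\<dots> \<le> card (badpairs K R)"
  proof (intro card_mono finite_badpairs image_subsetI)
    fix p assume "p \<in> ?S"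
    then show "(R (Suc p), R p) \<in> badpairs K R"
      by (intro adj_inversion_badpair[OF R]) (auto simp: acts_def)
  qed
  finally show ?thesis by simp
qed

text \<open>Under \<open>good\<close> every inverted neighbour pair is still randomised.\<close>

lemma viol_sum_le_unsure_gap:
  assumes R: "R \<in> lists_K K" and good: "good \<delta> K s m"
  shows "viol_sum t R \<le> unsure_gap t s m R"
  unfolding viol_sum_def unsure_gap_def
proof (rule sum_mono)
  fix p assume "p \<in> acts K t"
  then have p: "p \<in> {1..<K}" by (auto simp: acts_def)
  have "R p \<in> {1..K}" "R (Suc p) \<in> {1..K}" by (rule lists_K_in[OF R], use p in simp)+
  then have "R (Suc p) < R p \<Longrightarrow> unsure \<delta> s m p R"
    using good unfolding good_def unsure_def by auto
  then show "viol alpha R p \<le> (if unsure \<delta> s m p R then \<bar>alpha (R p) - alpha (R (Suc p))\<bar> else 0)"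
    using inversion_of_viol[OF R p] by (cases "viol alpha R p > 0") (auto simp: viol_def)
qed

text \<open>The difference telescopes over the neighbours between \<open>a\<close> and
  \<open>b\<close>, of which only the increases are kept; the two parities cover all
  neighbours.\<close>

lemma alpha_diff_le_viol:
  assumes "1 \<le> a" "a \<le> b" "b \<le> K"
  shows "alpha (R b) - alpha (R a) \<le> viol_sum t R + viol_sum (Suc t) R"
proof -
  have "alpha (R b) - alpha (R a) \<le> (\<Sum>p\<in>{a..<b}. viol alpha R p)"
    using assms(2)
  proof (induction b rule: dec_induct)
    case (step b)
    then show ?case by (simp add: viol_def)
  qed simp
  also have "\<dots> \<le> (\<Sum>p\<in>acts K t \<union> acts K (Suc t). viol alpha R p)"
    using assms by (intro sum_mono2 viol_nonneg) (auto simp: acts_def)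
  also have "\<dots> = viol_sum t R + viol_sum (Suc t) R"
    unfolding viol_sum_def by (intro sum.union_disjoint) (auto simp: acts_def)
  finally show ?thesis .
qed

lemma displayed_position:
  assumes "R \<in> set_pmf (display K \<delta> t s m Rb)" "l \<in> {1..K}"
  obtains a where "a \<in> {1..K}" "R l = Rb a" "l \<le> Suc a"
    "a \<le> l \<or> a = Suc l \<and> l \<in> acts K t \<and> unsure \<delta> s m l Rb"
proof -
  consider (first) "l \<in> acts K t" | (second) q where "q \<in> acts K t" "l = Suc q"
    | (none) "\<And>p. p \<in> acts K t \<Longrightarrow> l \<noteq> p \<and> l \<noteq> Suc p" by blast
  then show ?thesis
  proof cases
    case first
    then have "Suc l \<in> {1..K}" by (auto simp: acts_def)
    then show ?thesis using display_support(1)[OF assms(1) first] that[of l] that[of "Suc l"] assms(2) first by auto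
  next
    case second
    then have "q \<in> {1..K}" by (auto simp: acts_def)
    then show ?thesis using display_support(1)[OF assms(1) second(1)] that[of l] that[of q] assms(2) second by auto
  next
    case none
    then show ?thesis using display_support(2)[OF assms(1) none] that[of l] assms(2) by auto
  qed
qed

lemma displayed_alpha_diff:
  assumes Rb: "Rb \<in> lists_K K" and good: "good \<delta> K s m"
    and R: "R \<in> set_pmf (display K \<delta> t s m Rb)" and k: "1 \<le> k" "k < l" "l \<le> K"
  shows "alpha (R l) - alpha (R k) \<le> unsure_gap t s m Rb + viol_sum (Suc t) Rb"
proof -
  obtain a where a: "a \<in> {1..K}" "R k = Rb a" "k \<le> Suc a"
    "a \<le> k \<or> a = Suc k \<and> k \<in> acts K t \<and> unsure \<delta> s m k Rb"
    using displayed_position[OF R, of k] k by auto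
  obtain b where b: "b \<in> {1..K}" "R l = Rb b" "l \<le> Suc b"
    using displayed_position[OF R, of l] k by auto
  show ?thesis
  proof (cases "a \<le> b")
    case True
    then show ?thesis
      using alpha_diff_le_viol[of a b Rb t] viol_sum_le_unsure_gap[OF Rb good, of t] a b by simp
  next
    case False
    \<comment> \<open>Items move by at most one position, so two displayed items can have the
      opposite order in the base list only if they are a pair just exchanged. Their difference is
      then a single summand of \<open>unsure_gap\<close>.\<close>
    then have eq: "a = Suc k" "b = k" "k \<in> acts K t" "unsure \<delta> s m k Rb"
      using a(4) b(3) k by auto
    have "\<bar>alpha (Rb k) - alpha (Rb (Suc k))\<bar>
        = (if unsure \<delta> s m k Rb then \<bar>alpha (Rb k) - alpha (Rb (Suc k))\<bar> else 0)" using eq by simp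
    also have "\<dots> \<le> unsure_gap t s m Rb"
      unfolding unsure_gap_def using eq(3)
      by (intro member_le_sum[of k _ "\<lambda>p. if unsure \<delta> s m p Rb then \<bar>alpha (Rb p) - alpha (Rb (Suc p))\<bar> else 0"]) auto
    finally show ?thesis using a(2) b(2) eq(1,2) viol_sum_nonneg[of "Suc t" Rb] by simp
  qed
qed

text \<open>By A5, replacing \<open>chi R k\<close> by \<open>chi id k\<close> can only lower the
  reward of \<open>R\<close>. Then both lists carry the same weights, each at most
  \<open>chi_max\<close>.\<close>

lemma rew_diff_le:
  assumes R: "R \<in> lists_K K" and T: "T \<ge> 0" and d: "\<And>k. k \<in> {1..K} \<Longrightarrow> alpha k - alpha (R k) \<le> T"
  shows "rew K alpha chi id - rew K alpha chi R \<le> M * T"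
proof -
  have "rew K alpha chi id - rew K alpha chi R = (\<Sum>k=1..K. chi id k * alpha k - chi R k * alpha (R k))"
    by (simp add: rew_def sum_subtractf)
  also have "\<dots> \<le> (\<Sum>k=1..K. chi_max * T)"
  proof (rule sum_mono)
    fix k assume k: "k \<in> {1..K}"
    have "chi id k * alpha (R k) \<le> chi R k * alpha (R k)"
      using A5 R k alpha_bounds by (intro mult_right_mono) auto
    moreover have "chi id k * (alpha k - alpha (R k)) \<le> chi id k * T"
      using d[OF k] chi_nonneg by (intro mult_left_mono) auto
    moreover have "chi id k * T \<le> chi_max * T"
      using chi_le_max[OF id_lists_K k] T by (intro mult_right_mono) auto
    ultimately show "chi id k * alpha k - chi R k * alpha (R k) \<le> chi_max * T"
      by (simp add: algebra_simps)
  qed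
  also have "\<dots> = M * T" by (simp add: M_def)
  finally show ?thesis .
qed

lemma round_regret_le:
  assumes Rb: "Rb \<in> lists_K K" and good: "good \<delta> K s m" and R: "R \<in> set_pmf (display K \<delta> t s m Rb)"
  shows "rew K alpha chi id - rew K alpha chi R \<le> M * (unsure_gap t s m Rb + viol_sum (Suc t) Rb)"
proof (rule rew_diff_le)
  show RK: "R \<in> lists_K K" by (rule display_lists_K[OF Rb R])
  show nonneg: "unsure_gap t s m Rb + viol_sum (Suc t) Rb \<ge> 0"
    using viol_sum_nonneg by (auto simp: unsure_gap_def intro!: add_nonneg_nonneg sum_nonneg)
  fix k assume k: "k \<in> {1..K}"
  \<comment> \<open>An item at least as attractive as \<open>k\<close> sits at \<open>k\<close> or
    later, so the loss at position \<open>k\<close> is bounded by a difference between two displayed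
    positions.\<close>
  obtain k' where k': "k' \<in> {k..K}" "R k' \<in> {1..k}" using exists_later_better[OF RK k] by auto
  have "alpha k \<le> alpha (R k')" using k k' by (intro alpha_antimono) auto
  then show "alpha k - alpha (R k) \<le> unsure_gap t s m Rb + viol_sum (Suc t) Rb"
    using displayed_alpha_diff[OF Rb good R, of k k'] k k' nonneg by (cases "k = k'") auto
qed

end

context bubble_rank
begin

section \<open>Potential of a state\<close>

definition pairs :: "(nat \<times> nat) set" where
  "pairs = {(i, j). 1 \<le> i \<and> i < j \<and> j \<le> K}"

text \<open>In a valid state all other pairs have zero statistics; a pair that becomes tracked
  through an exchange in the base list thus enters with at most \<open>C\<close>.\<close>

definition tracked :: "(nat \<Rightarrow> nat \<Rightarrow> nat) \<Rightarrow> rlist \<Rightarrow> (nat \<times> nat) set" where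
  "tracked m R = {(i, j). (i, j) \<in> pairs \<and> (m i j > 0 \<or> (i, j) \<in> adj_pair R ` {1..<K})}"

definition pair_sum :: "(nat \<Rightarrow> nat \<Rightarrow> int) \<Rightarrow> (nat \<Rightarrow> nat \<Rightarrow> nat) \<Rightarrow> (nat \<times> nat) set \<Rightarrow> real" where
  "pair_sum s m T = (\<Sum>z\<in>T. psi (fst z) (snd z) (s (fst z) (snd z)) (m (fst z) (snd z)))"

text \<open>The negative term defers the cost of inverted pairs of the other parity to the next round, in which
  they are randomised.\<close>

definition potential :: "nat \<Rightarrow> (nat \<Rightarrow> nat \<Rightarrow> int) \<Rightarrow> (nat \<Rightarrow> nat \<Rightarrow> nat) \<Rightarrow> rlist \<Rightarrow> real" where
  "potential t s m R = pair_sum s m (tracked m R) + (2 * C + 5 * M) * card (badpairs K R)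
     + 2 * M * card (confident_wrong \<delta> K s m R) - M * viol_sum t R"

text \<open>The factor \<open>n * K\<close> bounds the regret of the whole run, and the sum is at
  least 1 as soon as some order is wrongly believed. From then on this term alone pays for all
  remaining rounds.\<close>

definition failure :: "nat \<Rightarrow> (nat \<Rightarrow> nat \<Rightarrow> int) \<Rightarrow> (nat \<Rightarrow> nat \<Rightarrow> nat) \<Rightarrow> real" where
  "failure n s m = real n * real K * (\<Sum>z\<in>pairs. deviation n (s (fst z) (snd z)) (m (fst z) (snd z)))"

lemma pairs_subset: "pairs \<subseteq> {1..K} \<times> {1..K}"
  by (auto simp: pairs_def)

lemma finite_pairs [simp]: "finite pairs"
  using pairs_subset by (rule finite_subset) simp

lemma tracked_subset: "tracked m R \<subseteq> pairs"
  by (auto simp: tracked_def)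

lemma finite_tracked [simp]: "finite (tracked m R)"
  using tracked_subset by (rule finite_subset) simp

lemma adj_pair_in_pairs:
  assumes "R \<in> lists_K K" "p \<in> {1..<K}"
  shows "adj_pair R p \<in> pairs"
  using adj_pair_range[OF assms] unfolding pairs_def by (cases "adj_pair R p") auto

lemma C_pos: "C > 0"
  unfolding C_def using M_pos chi_min_pos gap_min_pos L_pos by (simp add: add_pos_pos)

lemma pair_sum_nonneg: "T \<subseteq> pairs \<Longrightarrow> pair_sum s m T \<ge> 0"
  unfolding pair_sum_def by (intro sum_nonneg psi_nonneg) (auto simp: pairs_def)

text \<open>Compared pairs are handled by the assumption \<open>step\<close>, and the statistics of
  all other pairs stay fixed. It serves both \<open>psi\<close> and
  \<open>deviation\<close>.\<close>

lemma expected_pair_sum: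
  fixes f :: "nat \<Rightarrow> nat \<Rightarrow> int \<Rightarrow> nat \<Rightarrow> real" and pay :: "nat \<times> nat \<Rightarrow> real"
  assumes Rb: "Rb \<in> lists_K K" and T: "T \<subseteq> pairs"
    and step: "\<And>p i j. p \<in> acts K t \<Longrightarrow> (i, j) = adj_pair Rb p \<Longrightarrow>
       measure_pmf.expectation (outcomes t s m Rb)
         (\<lambda>w. f i j (fst (stats' t s m w) i j) (snd (stats' t s m w) i j))
       \<le> f i j (s i j) (m i j) - pay (i, j)"
  shows "measure_pmf.expectation (outcomes t s m Rb)
      (\<lambda>w. \<Sum>z\<in>T. f (fst z) (snd z) (fst (stats' t s m w) (fst z) (snd z)) (snd (stats' t s m w) (fst z) (snd z)))
    \<le> (\<Sum>z\<in>T. f (fst z) (snd z) (s (fst z) (snd z)) (m (fst z) (snd z)))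
       - (\<Sum>z\<in>T \<inter> adj_pair Rb ` acts K t. pay z)"
proof -
  let ?E = "measure_pmf.expectation (outcomes t s m Rb)"
  have fin: "finite (set_pmf (outcomes t s m Rb))" by (rule finite_outcomes[OF Rb])
  have finT: "finite T" using T by (rule finite_subset) simp
  have "?E (\<lambda>w. \<Sum>z\<in>T. f (fst z) (snd z) (fst (stats' t s m w) (fst z) (snd z)) (snd (stats' t s m w) (fst z) (snd z)))
     = (\<Sum>z\<in>T. ?E (\<lambda>w. f (fst z) (snd z) (fst (stats' t s m w) (fst z) (snd z)) (snd (stats' t s m w) (fst z) (snd z))))"
    by (intro Bochner_Integration.integral_sum integrable_measure_pmf_finite fin)
  also have "\<dots> \<le> (\<Sum>z\<in>T. f (fst z) (snd z) (s (fst z) (snd z)) (m (fst z) (snd z))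
       - (if z \<in> adj_pair Rb ` acts K t then pay z else 0))"
  proof (rule sum_mono)
    fix z assume z: "z \<in> T"
    obtain i j where ij: "z = (i, j)" by (cases z)
    show "?E (\<lambda>w. f (fst z) (snd z) (fst (stats' t s m w) (fst z) (snd z)) (snd (stats' t s m w) (fst z) (snd z)))
       \<le> f (fst z) (snd z) (s (fst z) (snd z)) (m (fst z) (snd z))
          - (if z \<in> adj_pair Rb ` acts K t then pay z else 0)"
    proof (cases "z \<in> adj_pair Rb ` acts K t")
      case True
      then obtain p where "p \<in> acts K t" "(i, j) = adj_pair Rb p" using ij by auto
      from step[OF this] True show ?thesis by (simp add: ij)
    next
      case False
      have "i < j" using z T ij by (auto simp: pairs_def)
      then have "?E (\<lambda>w. f i j (fst (stats' t s m w) i j) (snd (stats' t s m w) i j))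
          = ?E (\<lambda>w. f i j (s i j) (m i j))"
        using False ij by (intro expectation_cong_pmf) (simp add: stats_inactive[OF Rb])
      then show ?thesis using False by (simp add: ij)
    qed
  qed
  also have "\<dots> = (\<Sum>z\<in>T. f (fst z) (snd z) (s (fst z) (snd z)) (m (fst z) (snd z)))
       - (\<Sum>z\<in>T \<inter> adj_pair Rb ` acts K t. pay z)"
    using finT by (simp add: sum_subtractf sum.inter_restrict)
  finally show ?thesis .
qed

definition pay :: "(nat \<Rightarrow> nat \<Rightarrow> int) \<Rightarrow> (nat \<Rightarrow> nat \<Rightarrow> nat) \<Rightarrow> nat \<times> nat \<Rightarrow> real" where
  "pay s m z = (if real_of_int (s (fst z) (snd z)) \<le> thr \<delta> (m (fst z) (snd z))
     then 2 * M * (alpha (fst z) - alpha (snd z)) else 0)"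

text \<open>Randomisation tests the order of the base list, whereas \<open>pay\<close> tests the
  true order. They differ for an inverted pair whose true order is already known with confidence;
  these positions are counted in \<open>confident_wrong\<close> and cost at most
  \<open>2 * M\<close> each.\<close>

lemma unsure_gap_le_pay:
  assumes Rb: "Rb \<in> lists_K K"
  shows "2 * M * unsure_gap t s m Rb
    \<le> (\<Sum>p\<in>acts K t. pay s m (adj_pair Rb p)) + 2 * M * card (confident_wrong \<delta> K s m Rb)"
proof -
  have "2 * M * (if unsure \<delta> s m p Rb then \<bar>alpha (Rb p) - alpha (Rb (Suc p))\<bar> else 0)
      \<le> pay s m (adj_pair Rb p) + 2 * M * of_bool (p \<in> confident_wrong \<delta> K s m Rb)" if "p \<in> acts K t" for p
  proof -
    have p: "p \<in> {1..<K}" using that by (auto simp: acts_def)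
    have in1: "Rb p \<in> {1..K}" "Rb (Suc p) \<in> {1..K}" by (rule lists_K_in[OF Rb], use p in simp)+
    have "Rb p \<noteq> Rb (Suc p)" using lists_K_inj[OF Rb] by (simp add: inj_eq)
    then consider "Rb p < Rb (Suc p)" | "Rb (Suc p) < Rb p" by linarith
    then show ?thesis
    proof cases
      case 1
      then have "adj_pair Rb p = (Rb p, Rb (Suc p))" by (simp add: adj_pair_def)
      moreover have "alpha (Rb (Suc p)) < alpha (Rb p)" using 1 in1 by (intro alpha_strict) auto
      ultimately show ?thesis using M_pos by (simp add: pay_def unsure_def)
    next
      case 2
      then have adj: "adj_pair Rb p = (Rb (Suc p), Rb p)" by (simp add: adj_pair_def)
      have lt: "alpha (Rb p) < alpha (Rb (Suc p))" using 2 in1 by (intro alpha_strict) auto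
      show ?thesis
      proof (cases "real_of_int (s (Rb (Suc p)) (Rb p)) \<le> thr \<delta> (m (Rb (Suc p)) (Rb p))")
        case True
        then show ?thesis using M_pos lt by (simp add: pay_def adj)
      next
        case False
        then have "p \<in> confident_wrong \<delta> K s m Rb" using p by (simp add: confident_wrong_def)
        moreover have "\<bar>alpha (Rb p) - alpha (Rb (Suc p))\<bar> \<le> 1"
          using alpha_bounds[of "Rb p"] alpha_bounds[of "Rb (Suc p)"] by linarith
        ultimately show ?thesis using M_pos False by (simp add: pay_def adj)
      qed
    qed
  qed
  then have "2 * M * unsure_gap t s m Rb \<le>
      (\<Sum>p\<in>acts K t. pay s m (adj_pair Rb p) + 2 * M * of_bool (p \<in> confident_wrong \<delta> K s m Rb))"
    unfolding unsure_gap_def sum_distrib_left by (rule sum_mono)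
  also have "\<dots> = (\<Sum>p\<in>acts K t. pay s m (adj_pair Rb p))
      + 2 * M * (\<Sum>p\<in>acts K t. of_bool (p \<in> confident_wrong \<delta> K s m Rb))"
    by (simp only: sum.distrib sum_distrib_left)
  also have "(\<Sum>p\<in>acts K t. of_bool (p \<in> confident_wrong \<delta> K s m Rb) :: real)
      \<le> card (confident_wrong \<delta> K s m Rb)"
    by (simp add: sum_of_bool_eq card_mono)
  finally show ?thesis using M_pos by simp
qed

lemma expected_pair_sum_psi:
  assumes Rb: "Rb \<in> lists_K K" and good: "good \<delta> K s m"
  shows "measure_pmf.expectation (outcomes t s m Rb)
      (\<lambda>w. pair_sum (fst (stats' t s m w)) (snd (stats' t s m w)) (tracked m Rb))
    \<le> pair_sum s m (tracked m Rb) - (\<Sum>p\<in>acts K t. pay s m (adj_pair Rb p))"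
proof -
  have "adj_pair Rb p \<in> tracked m Rb" if "p \<in> acts K t" for p
  proof -
    have p: "p \<in> {1..<K}" using that by (auto simp: acts_def)
    then have "adj_pair Rb p \<in> adj_pair Rb ` {1..<K}" by (rule imageI)
    then show ?thesis using adj_pair_in_pairs[OF Rb p] unfolding tracked_def by (cases "adj_pair Rb p") simp
  qed
  then have "tracked m Rb \<inter> adj_pair Rb ` acts K t = adj_pair Rb ` acts K t" by auto
  then have "(\<Sum>z\<in>tracked m Rb \<inter> adj_pair Rb ` acts K t. pay s m z)
      = (\<Sum>p\<in>acts K t. pay s m (adj_pair Rb p))"
    by (simp add: sum.reindex[OF inj_on_adj_pair[OF lists_K_inj[OF Rb]]])
  moreover have "measure_pmf.expectation (outcomes t s m Rb)
      (\<lambda>w. pair_sum (fst (stats' t s m w)) (snd (stats' t s m w)) (tracked m Rb))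
    \<le> pair_sum s m (tracked m Rb) - (\<Sum>z\<in>tracked m Rb \<inter> adj_pair Rb ` acts K t. pay s m z)"
    unfolding pair_sum_def
    by (rule expected_pair_sum[OF Rb tracked_subset], unfold pay_def fst_conv snd_conv,
        rule psi_expected_step[OF Rb good])
  ultimately show ?thesis by simp
qed

lemma expected_failure:
  assumes Rb: "Rb \<in> lists_K K" and good: "good \<delta> K s m"
  shows "measure_pmf.expectation (outcomes t s m Rb)
      (\<lambda>w. failure n (fst (stats' t s m w)) (snd (stats' t s m w))) \<le> failure n s m"
proof -
  have "measure_pmf.expectation (outcomes t s m Rb)
      (\<lambda>w. \<Sum>z\<in>pairs. deviation n (fst (stats' t s m w) (fst z) (snd z)) (snd (stats' t s m w) (fst z) (snd z)))
    \<le> (\<Sum>z\<in>pairs. deviation n (s (fst z) (snd z)) (m (fst z) (snd z)))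
       - (\<Sum>z\<in>pairs \<inter> adj_pair Rb ` acts K t. 0)"
    by (rule expected_pair_sum[where f = "\<lambda>_ _. deviation n" and pay = "\<lambda>_. 0", OF Rb order_refl])
       (use deviation_expected_step[OF Rb good] in simp)
  then show ?thesis unfolding failure_def by (simp add: mult_left_mono)
qed

lemma failure_nonneg: "failure n s m \<ge> 0"
  unfolding failure_def by (intro mult_nonneg_nonneg sum_nonneg deviation_nonneg) auto

lemma failure_ge:
  assumes valid: "valid t s m R" and bad: "\<not> good \<delta> K s m" and t: "t \<le> n"
  shows "failure n s m \<ge> real n * real K"
proof -
  obtain i j where ij: "1 \<le> i" "i < j" "j \<le> K" "real_of_int (s j i) > thr \<delta> (m j i)"
    using bad unfolding good_def by (auto simp: not_le)
  have v: "s j i = - s i j" "m j i = m i j" "\<bar>s i j\<bar> \<le> int (m i j)" "m i j \<le> t"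
    using valid unfolding valid_def by blast+
  \<comment> \<open>The sum in \<open>deviation\<close> starts at \<open>k = 1\<close>, so at least
    one comparison must have taken place.\<close>
  have "s j i > 0" using ij(4) thr_nonneg[OF delta(1) delta_lt_1, of "m j i"] by linarith
  then have m1: "1 \<le> m i j" using v by linarith
  have "1 \<le> deviation n (s i j) (m i j)"
    using ij(4) v m1 t by (intro deviation_ge_1) auto
  also have "\<dots> \<le> (\<Sum>z\<in>pairs. deviation n (s (fst z) (snd z)) (m (fst z) (snd z)))"
    using ij member_le_sum[of "(i, j)" pairs "\<lambda>z. deviation n (s (fst z) (snd z)) (m (fst z) (snd z))"]
    by (auto simp: pairs_def[symmetric] deviation_nonneg) (auto simp: pairs_def)
  finally show ?thesis unfolding failure_def
    using mult_left_mono[of 1 _ "real n * real K"] by simp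
qed

text \<open>Each exchange removes an inversion and releases \<open>2 * C + 5 * M\<close>:
  \<open>2 * C\<close> for two newly tracked pairs, \<open>2 * M\<close> for a confidently wrong
  position left behind, \<open>3 * M\<close> for the change of \<open>viol_sum\<close>. The set
  \<open>T\<close> allows the tracked pairs to be fixed before the random outcome of the
  round.\<close>

lemma potential_upd_base:
  assumes valid: "valid t s m R" and Rb: "Rb \<in> lists_K K" and good: "good \<delta> K s m"
    and T: "T \<subseteq> pairs" "\<And>i j. (i, j) \<in> pairs \<Longrightarrow> m i j > 0 \<or> (i, j) \<in> adj_pair Rb ` {1..<K} \<Longrightarrow> (i, j) \<in> T"
  shows "potential u s m (upd_base K \<delta> s m Rb)
    \<le> pair_sum s m T + (2 * C + 5 * M) * card (badpairs K Rb) - M * viol_sum u Rb"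
proof -
  let ?R = "upd_base K \<delta> s m Rb"
  have v: "s j i = - s i j" "\<bar>s i j\<bar> \<le> int (m i j)" for i j
    using valid unfolding valid_def by blast+
  have al: "0 \<le> alpha i \<and> alpha i \<le> 1" for i using alpha_bounds by simp
  have K1: "1 \<le> K" using K_ge_2 by simp
  obtain N where N: "card (badpairs K ?R) + N = card (badpairs K Rb)"
    "card (adj_pair ?R ` {1..<K} - adj_pair Rb ` {1..<K}) \<le> 2 * N"
    "card (confident_wrong \<delta> K s m ?R) \<le> N"
    "viol_sum u Rb \<le> viol_sum u ?R + 3 * real N"
    unfolding viol_sum_def
    by (rule upd_base_progress[where \<alpha> = alpha and t = u, OF Rb good delta(1) delta_lt_1 v(1) al K1])
  have finT: "finite T" using T(1) by (rule finite_subset) simp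
  have "pair_sum s m (tracked m ?R) \<le> pair_sum s m T + 2 * real N * C"
  proof -
    let ?f = "\<lambda>z. psi (fst z) (snd z) (s (fst z) (snd z)) (m (fst z) (snd z))"
    have new: "?f z \<le> C" if "z \<in> tracked m ?R - T" for z
    proof -
      obtain i j where ij: "z = (i, j)" by (cases z)
      have "(i, j) \<in> pairs" using that ij tracked_subset by blast
      moreover have "m i j = 0" using that ij T(2)[of i j] calculation by (cases "m i j = 0") auto
      moreover have "s i j = 0" using v(2)[of i j] \<open>m i j = 0\<close> by simp
      ultimately show ?thesis using psi_zero_le[of i j] by (simp add: ij pairs_def)
    qed
    have "tracked m ?R - T \<subseteq> adj_pair ?R ` {1..<K} - adj_pair Rb ` {1..<K}"
    proof
      fix z assume z: "z \<in> tracked m ?R - T"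
      obtain i j where ij: "z = (i, j)" by (cases z)
      have "(i, j) \<in> pairs" using z ij tracked_subset by blast
      then show "z \<in> adj_pair ?R ` {1..<K} - adj_pair Rb ` {1..<K}"
        using z T(2)[of i j] unfolding ij tracked_def by blast
    qed
    then have "card (tracked m ?R - T) \<le> card (adj_pair ?R ` {1..<K} - adj_pair Rb ` {1..<K})"
      by (intro card_mono) auto
    then have "card (tracked m ?R - T) \<le> 2 * N" using N(2) by linarith
    then have cardN: "real (card (tracked m ?R - T)) \<le> 2 * real N" by linarith
    have "pair_sum s m (tracked m ?R) \<le> (\<Sum>z\<in>T \<union> (tracked m ?R - T). ?f z)"
      unfolding pair_sum_def using finT T(1) tracked_subset[of m ?R]
      by (intro sum_mono2 psi_nonneg) (auto simp: pairs_def)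
    also have "\<dots> = pair_sum s m T + (\<Sum>z\<in>tracked m ?R - T. ?f z)"
      unfolding pair_sum_def using finT by (intro sum.union_disjoint) auto
    also have "(\<Sum>z\<in>tracked m ?R - T. ?f z) \<le> card (tracked m ?R - T) * C"
      using new by (intro sum_bounded_above) auto
    also have "\<dots> \<le> 2 * real N * C" using cardN C_pos by (intro mult_right_mono) auto
    finally show ?thesis by simp
  qed
  moreover have "real (card (badpairs K Rb)) = real (card (badpairs K ?R)) + real N" using N(1) by linarith
  moreover have "M * card (confident_wrong \<delta> K s m ?R) \<le> M * N" using N(3) M_pos by simp
  moreover have "M * viol_sum u Rb \<le> M * (viol_sum u ?R + 3 * real N)"
    using N(4) M_pos by (intro mult_left_mono) auto
  ultimately show ?thesis unfolding potential_def by (simp add: algebra_simps)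
qed

lemma potential_core_nonneg:
  assumes "T \<subseteq> pairs" "R \<in> lists_K K"
  shows "pair_sum s m T + (2 * C + 5 * M) * card (badpairs K R) - M * viol_sum u R \<ge> 0"
proof -
  have "M * viol_sum u R \<le> M * card (badpairs K R)"
    using viol_sum_le_badpairs[OF assms(2), of u] M_pos by (intro mult_left_mono) auto
  also have "\<dots> \<le> (2 * C + 5 * M) * card (badpairs K R)"
    using M_pos C_pos by (intro mult_right_mono) auto
  finally show ?thesis using pair_sum_nonneg[OF assms(1), of s m] by simp
qed

lemma potential_nonneg: "R \<in> lists_K K \<Longrightarrow> potential t s m R \<ge> 0"
  unfolding potential_def using potential_core_nonneg[OF tracked_subset, of R s m m R t] M_pos
  by (smt (verit) mult_nonneg_nonneg of_nat_0_le_iff)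

text \<open>The payments and the \<open>confident_wrong\<close> term yield
  \<open>2 * M * unsure_gap\<close>. One half pays regret; the other cancels the deferred
  \<open>M * viol_sum t\<close>, which is no larger, while \<open>M * viol_sum (Suc t)\<close> is
  deferred anew. After a failure the potential counts as 0, which only lowers the left side.\<close>

lemma potential_expected_step:
  fixes t :: nat
  assumes valid: "valid t' s m Rb" and good: "good \<delta> K s m"
  defines "E \<equiv> measure_pmf.expectation (outcomes t s m Rb)"
  shows "E (\<lambda>w. (if good \<delta> K (fst (stats' t s m w)) (snd (stats' t s m w))
        then potential (Suc t) (fst (stats' t s m w)) (snd (stats' t s m w))
           (upd_base K \<delta> (fst (stats' t s m w)) (snd (stats' t s m w)) Rb) else 0)
        + failure n (fst (stats' t s m w)) (snd (stats' t s m w)))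
    \<le> potential t s m Rb + failure n s m - M * (unsure_gap t s m Rb + viol_sum (Suc t) Rb)"
proof -
  have Rb: "Rb \<in> lists_K K" using valid unfolding valid_def by blast
  have fin: "finite (set_pmf (outcomes t s m Rb))" by (rule finite_outcomes[OF Rb])
  note int = integrable_measure_pmf_finite[OF fin]
  let ?T = "tracked m Rb"
  let ?c = "(2 * C + 5 * M) * card (badpairs K Rb) - M * viol_sum (Suc t) Rb"
  have pt: "(if good \<delta> K (fst (stats' t s m w)) (snd (stats' t s m w))
        then potential (Suc t) (fst (stats' t s m w)) (snd (stats' t s m w))
           (upd_base K \<delta> (fst (stats' t s m w)) (snd (stats' t s m w)) Rb) else 0)
     \<le> pair_sum (fst (stats' t s m w)) (snd (stats' t s m w)) ?T + ?c"
    if w: "w \<in> set_pmf (outcomes t s m Rb)" for w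
  proof -
    let ?s = "fst (stats' t s m w)" and ?m = "snd (stats' t s m w)"
    \<comment> \<open>A pair compared in this round is adjacent in \<open>Rb\<close>, hence was
      tracked before the round.\<close>
    have T: "(i, j) \<in> ?T" if ij: "(i, j) \<in> pairs" "?m i j > 0 \<or> (i, j) \<in> adj_pair Rb ` {1..<K}" for i j
    proof (cases "(i, j) \<in> adj_pair Rb ` {1..<K}")
      case True
      then show ?thesis using ij by (simp add: tracked_def)
    next
      case False
      then have "(i, j) \<notin> adj_pair Rb ` acts K t" by (auto simp: acts_def)
      moreover have "i < j" using ij by (simp add: pairs_def)
      ultimately have "?m i j = m i j" by (intro stats_inactive(2)[OF Rb w])
      then show ?thesis using ij False by (simp add: tracked_def)
    qed
    show ?thesis
    proof (cases "good \<delta> K ?s ?m")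
      case True
      then show ?thesis
        using potential_upd_base[OF valid_step[OF valid w] Rb True tracked_subset T, of "Suc t"] by simp
    next
      case False
      then show ?thesis using potential_core_nonneg[OF tracked_subset Rb, of ?s ?m m Rb "Suc t"] by simp
    qed
  qed
  have "E (\<lambda>w. (if good \<delta> K (fst (stats' t s m w)) (snd (stats' t s m w))
        then potential (Suc t) (fst (stats' t s m w)) (snd (stats' t s m w))
           (upd_base K \<delta> (fst (stats' t s m w)) (snd (stats' t s m w)) Rb) else 0)
        + failure n (fst (stats' t s m w)) (snd (stats' t s m w)))
      \<le> E (\<lambda>w. (pair_sum (fst (stats' t s m w)) (snd (stats' t s m w)) ?T + ?c)
        + failure n (fst (stats' t s m w)) (snd (stats' t s m w)))"
    unfolding E_def by (intro expectation_mono_finite fin add_right_mono pt)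
  also have "\<dots> = E (\<lambda>w. pair_sum (fst (stats' t s m w)) (snd (stats' t s m w)) ?T) + ?c
        + E (\<lambda>w. failure n (fst (stats' t s m w)) (snd (stats' t s m w)))"
    unfolding E_def
    by (subst Bochner_Integration.integral_add[OF int int], subst Bochner_Integration.integral_add[OF int int]) simp
  also have "\<dots> \<le> (pair_sum s m ?T - (\<Sum>p\<in>acts K t. pay s m (adj_pair Rb p))) + ?c + failure n s m"
    unfolding E_def
    by (intro add_mono expected_pair_sum_psi[OF Rb good] expected_failure[OF Rb good] order_refl)
  finally have main: "E (\<lambda>w. (if good \<delta> K (fst (stats' t s m w)) (snd (stats' t s m w))
        then potential (Suc t) (fst (stats' t s m w)) (snd (stats' t s m w))
           (upd_base K \<delta> (fst (stats' t s m w)) (snd (stats' t s m w)) Rb) else 0)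
        + failure n (fst (stats' t s m w)) (snd (stats' t s m w)))
      \<le> (pair_sum s m ?T - (\<Sum>p\<in>acts K t. pay s m (adj_pair Rb p))) + ?c + failure n s m" .
  have "M * viol_sum t Rb \<le> M * unsure_gap t s m Rb"
    using viol_sum_le_unsure_gap[OF Rb good] M_pos by simp
  then show ?thesis
    using main unsure_gap_le_pay[OF Rb, of t s m] unfolding potential_def by (simp add: algebra_simps)
qed

end

section \<open>Expected regret\<close>

lemma rew_bounds:
  "0 \<le> rew K (attr PA) (exam PX) R" "rew K (attr PA) (exam PX) R \<le> K"
proof -
  show "0 \<le> rew K (attr PA) (exam PX) R"
    unfolding rew_def by (intro sum_nonneg mult_nonneg_nonneg) (simp_all add: attr_def exam_def)
  have "rew K (attr PA) (exam PX) R \<le> (\<Sum>k=1..K. 1)"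
    unfolding rew_def by (intro sum_mono mult_le_one) (simp_all add: attr_def exam_def)
  then show "rew K (attr PA) (exam PX) R \<le> K" by simp
qed

lemma bubble_state_lists_K:
  assumes "R0 \<in> lists_K K" "(s, m, Rb) \<in> set_pmf (bubble_state PA PX K \<delta> R0 T)"
  shows "Rb \<in> lists_K K"
  using assms(2)
proof (induction T arbitrary: s m Rb)
  case 0
  then show ?case using assms(1) by simp
next
  case (Suc T)
  then obtain s0 m0 Rb0 where "(s0, m0, Rb0) \<in> set_pmf (bubble_state PA PX K \<delta> R0 T)"
    "(s, m, Rb) \<in> set_pmf (bubble_step PA PX K \<delta> (Suc T) (s0, m0, Rb0))" by auto
  then show ?case using Suc.IH by (auto simp: bubble_step_def Let_def intro: upd_base_lists_K)
qed

lemma displayed_lists_K: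
  assumes "R0 \<in> lists_K K" "R \<in> set_pmf (displayed PA PX K \<delta> R0 t)"
  shows "R \<in> lists_K K"
  using assms(2) bubble_state_lists_K[OF assms(1)] display_lists_K
  unfolding displayed_def by fastforce

lemma regret_le_const:
  assumes R0: "R0 \<in> lists_K K"
    and c: "\<And>R. R \<in> lists_K K \<Longrightarrow>
      Max (rew K (attr PA) (exam PX) ` lists_K K) - rew K (attr PA) (exam PX) R \<le> c"
  shows "regret PA PX K \<delta> R0 n \<le> real n * c"
proof -
  have "measure_pmf.expectation (displayed PA PX K \<delta> R0 t)
        (\<lambda>R. Max ((rew K (attr PA) (exam PX)) ` lists_K K) - rew K (attr PA) (exam PX) R)
      \<le> measure_pmf.expectation (displayed PA PX K \<delta> R0 t) (\<lambda>_. c)" for t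
  proof (rule expectation_mono_finite)
    show "finite (set_pmf (displayed PA PX K \<delta> R0 t))"
      by (rule finite_subset[OF _ finite_lists_K[of K]]) (auto intro: displayed_lists_K[OF R0])
  qed (intro c displayed_lists_K[OF R0])
  then have "regret PA PX K \<delta> R0 n \<le> (\<Sum>t=1..n. c)"
    unfolding regret_def by (intro sum_mono) simp
  then show ?thesis by simp
qed

lemma regret_le_trivial:
  assumes "R0 \<in> lists_K K"
  shows "regret PA PX K \<delta> R0 n \<le> real n * real K"
proof (rule regret_le_const[OF assms])
  fix R
  have "Max (rew K (attr PA) (exam PX) ` lists_K K) \<le> real K"
    using rew_bounds(2) assms by (subst Max_le_iff) auto
  then show "Max (rew K (attr PA) (exam PX) ` lists_K K) - rew K (attr PA) (exam PX) R \<le> real K"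
    using rew_bounds(1)[of K PA PX R] by linarith
qed

context bubble_rank
begin

lemma Max_rew: "Max (rew K alpha chi ` lists_K K) = rew K alpha chi id"
  by (rule Max_eqI) (use A1 in auto)

text \<open>Expected regret of the next \<open>r\<close> rounds from a state reached after
  \<open>T\<close> rounds. Unfolding at the first round makes the one-step estimate applicable to
  any state, not only to averages over states.\<close>

primrec regret_to_go :: "nat \<Rightarrow> nat \<Rightarrow> bstate \<Rightarrow> real" where
  "regret_to_go 0 T st = 0"
| "regret_to_go (Suc r) T st =
     measure_pmf.expectation (display K \<delta> (Suc T) (fst st) (fst (snd st)) (snd (snd st)))
       (\<lambda>R. rew K alpha chi id - rew K alpha chi R)
     + measure_pmf.expectation (bubble_step PA PX K \<delta> (Suc T) st) (regret_to_go r (Suc T))"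

lemma expectation_bubble_step:
  fixes f :: "bstate \<Rightarrow> real"
  assumes "Rb \<in> lists_K K"
  shows "measure_pmf.expectation (bubble_step PA PX K \<delta> t (s, m, Rb)) f
    = measure_pmf.expectation (outcomes t s m Rb) (\<lambda>w. f (fst (stats' t s m w), snd (stats' t s m w),
        upd_base K \<delta> (fst (stats' t s m w)) (snd (stats' t s m w)) Rb))"
  unfolding bubble_step_eq[OF assms] by (simp add: next_state_def Let_def)

lemma regret_to_go_le:
  assumes "valid T s m Rb"
  shows "regret_to_go r T (s, m, Rb) \<le> real r * K"
  using assms
proof (induction r arbitrary: T s m Rb)
  case (Suc r)
  have Rb: "Rb \<in> lists_K K" using Suc.prems unfolding valid_def by blast
  have "measure_pmf.expectation (display K \<delta> (Suc T) s m Rb) (\<lambda>R. rew K alpha chi id - rew K alpha chi R)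
      \<le> measure_pmf.expectation (display K \<delta> (Suc T) s m Rb) (\<lambda>_. real K)"
  proof (intro expectation_mono_finite finite_display[OF Rb])
    fix R show "rew K alpha chi id - rew K alpha chi R \<le> real K"
      using rew_bounds(2)[of K PA PX id] rew_bounds(1)[of K PA PX R] by linarith
  qed
  moreover have "measure_pmf.expectation (bubble_step PA PX K \<delta> (Suc T) (s, m, Rb)) (regret_to_go r (Suc T))
      \<le> measure_pmf.expectation (outcomes (Suc T) s m Rb) (\<lambda>_. real r * K)"
    unfolding expectation_bubble_step[OF Rb]
    by (intro expectation_mono_finite finite_outcomes[OF Rb] Suc.IH valid_step[OF Suc.prems])
  ultimately show ?case by (simp add: algebra_simps)
qed simp

text \<open>In a state with a wrong belief, \<open>failure\<close> covers the trivial bound on all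
  remaining rounds. Otherwise the expected loss of potential in the next round covers its
  regret.\<close>

lemma regret_to_go_le_potential:
  assumes "valid T s m Rb" "T + r \<le> n"
  shows "regret_to_go r T (s, m, Rb)
    \<le> (if good \<delta> K s m then potential (Suc T) s m Rb else 0) + failure n s m"
  using assms
proof (induction r arbitrary: T s m Rb)
  case 0
  have "Rb \<in> lists_K K" using "0.prems" unfolding valid_def by blast
  then show ?case using potential_nonneg[of Rb "Suc T" s m] failure_nonneg[of n s m] by simp
next
  case (Suc r)
  have Rb: "Rb \<in> lists_K K" using Suc.prems unfolding valid_def by blast
  show ?case
  proof (cases "good \<delta> K s m")
    case False
    have "regret_to_go (Suc r) T (s, m, Rb) \<le> real (Suc r) * K" by (rule regret_to_go_le[OF Suc.prems(1)])
    also have "\<dots> \<le> real n * real K" using Suc.prems(2) by (intro mult_right_mono) auto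
    also have "\<dots> \<le> failure n s m"
      using Suc.prems(2) by (intro failure_ge[OF Suc.prems(1) False]) auto
    finally show ?thesis using False by simp
  next
    case True
    let ?c = "M * (unsure_gap (Suc T) s m Rb + viol_sum (Suc (Suc T)) Rb)"
    have "measure_pmf.expectation (display K \<delta> (Suc T) s m Rb) (\<lambda>R. rew K alpha chi id - rew K alpha chi R)
        \<le> measure_pmf.expectation (display K \<delta> (Suc T) s m Rb) (\<lambda>_. ?c)"
      by (intro expectation_mono_finite finite_display[OF Rb] round_regret_le[OF Rb True])
    moreover have "measure_pmf.expectation (bubble_step PA PX K \<delta> (Suc T) (s, m, Rb)) (regret_to_go r (Suc T))
        \<le> potential (Suc T) s m Rb + failure n s m - ?c"
    proof -
      have "measure_pmf.expectation (bubble_step PA PX K \<delta> (Suc T) (s, m, Rb)) (regret_to_go r (Suc T))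
        \<le> measure_pmf.expectation (outcomes (Suc T) s m Rb)
           (\<lambda>w. (if good \<delta> K (fst (stats' (Suc T) s m w)) (snd (stats' (Suc T) s m w))
            then potential (Suc (Suc T)) (fst (stats' (Suc T) s m w)) (snd (stats' (Suc T) s m w))
             (upd_base K \<delta> (fst (stats' (Suc T) s m w)) (snd (stats' (Suc T) s m w)) Rb) else 0)
            + failure n (fst (stats' (Suc T) s m w)) (snd (stats' (Suc T) s m w)))"
        unfolding expectation_bubble_step[OF Rb] using Suc.prems(2)
        by (intro expectation_mono_finite finite_outcomes[OF Rb] Suc.IH valid_step[OF Suc.prems(1)]) auto
      also have "\<dots> \<le> potential (Suc T) s m Rb + failure n s m - ?c"
        by (rule potential_expected_step[OF Suc.prems(1) True])
      finally show ?thesis .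
    qed
    ultimately show ?thesis using True by simp
  qed
qed

lemma finite_bubble_state:
  assumes R0: "R0 \<in> lists_K K"
  shows "finite (set_pmf (bubble_state PA PX K \<delta> R0 T))"
proof (induction T)
  case (Suc T)
  have "finite (set_pmf (bubble_step PA PX K \<delta> (Suc T) st))"
    if "st \<in> set_pmf (bubble_state PA PX K \<delta> R0 T)" for st
  proof -
    obtain s m Rb where st: "st = (s, m, Rb)" by (cases st)
    then have Rb: "Rb \<in> lists_K K" using bubble_state_lists_K[OF R0] that by blast
    show ?thesis unfolding st bubble_step_eq[OF Rb] using finite_outcomes[OF Rb] by simp
  qed
  then show ?case using Suc by simp
qed simp

lemma finite_bubble_step:
  assumes "R0 \<in> lists_K K" "st \<in> set_pmf (bubble_state PA PX K \<delta> R0 T)"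
  shows "finite (set_pmf (bubble_step PA PX K \<delta> (Suc T) st))"
proof (rule finite_subset)
  show "set_pmf (bubble_step PA PX K \<delta> (Suc T) st) \<subseteq> set_pmf (bubble_state PA PX K \<delta> R0 (Suc T))"
    using assms(2) by auto
  show "finite (set_pmf (bubble_state PA PX K \<delta> R0 (Suc T)))" by (rule finite_bubble_state[OF assms(1)])
qed

text \<open>The list of round \<open>Suc T\<close> and the next state are both drawn from the state
  after \<open>T\<close> rounds, so the claim follows by conditioning on that state and
  linearity.\<close>

lemma sum_displayed_regret:
  assumes R0: "R0 \<in> lists_K K"
  shows "(\<Sum>t=Suc T..T + r. measure_pmf.expectation (displayed PA PX K \<delta> R0 t)
            (\<lambda>R. rew K alpha chi id - rew K alpha chi R))
     = measure_pmf.expectation (bubble_state PA PX K \<delta> R0 T) (regret_to_go r T)"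
proof (induction r arbitrary: T)
  case (Suc r)
  let ?reg = "\<lambda>R. rew K alpha chi id - rew K alpha chi R"
  let ?D = "\<lambda>st. display K \<delta> (Suc T) (fst st) (fst (snd st)) (snd (snd st))"
  let ?B = "bubble_state PA PX K \<delta> R0 T"
  note fin = finite_bubble_state[OF R0]
  have finD: "finite (set_pmf (?D st))" if "st \<in> set_pmf ?B" for st
    using bubble_state_lists_K[OF R0, of "fst st" "fst (snd st)" "snd (snd st)"] that
    by (intro finite_display) simp
  have disp: "displayed PA PX K \<delta> R0 (Suc T) = bind_pmf ?B ?D"
    unfolding displayed_def by (simp add: case_prod_unfold)
  have "(\<Sum>t=Suc T..T + Suc r. measure_pmf.expectation (displayed PA PX K \<delta> R0 t) ?reg)
      = measure_pmf.expectation (displayed PA PX K \<delta> R0 (Suc T)) ?reg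
        + (\<Sum>t=Suc (Suc T)..Suc T + r. measure_pmf.expectation (displayed PA PX K \<delta> R0 t) ?reg)"
    by (subst sum.atLeast_Suc_atMost) auto
  also have "\<dots> = measure_pmf.expectation ?B (\<lambda>st. measure_pmf.expectation (?D st) ?reg)
      + measure_pmf.expectation ?B (\<lambda>st. measure_pmf.expectation (bubble_step PA PX K \<delta> (Suc T) st) (regret_to_go r (Suc T)))"
    unfolding Suc.IH[of "Suc T"] disp bubble_state.simps
    by (intro arg_cong2[where f = "(+)"] expectation_bind_pmf_finite fin finD finite_bubble_step[OF R0])
  also have "\<dots> = measure_pmf.expectation ?B (regret_to_go (Suc r) T)"
    unfolding regret_to_go.simps(2)[abs_def]
    by (intro Bochner_Integration.integral_add[symmetric] integrable_measure_pmf_finite fin)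
  finally show ?case .
next
  case 0
  have "regret_to_go 0 T = (\<lambda>_. 0)" by (rule ext) simp
  then show ?case by simp
qed

section \<open>Initial values and the final constants\<close>

lemma L_ge: "L \<ge> 8 / 3"
proof -
  have "ln 16 = 4 * ln (2::real)" using ln_realpow[of 2 4] by simp
  moreover have "ln 16 \<le> L" unfolding L_def using delta by (intro ln_mono) (auto simp: field_simps)
  ultimately show ?thesis using ln2_ge_two_thirds by simp
qed

lemma potential_init_le:
  assumes R0: "R0 \<in> lists_K K"
  shows "potential t (\<lambda>_ _. 0) (\<lambda>_ _. 0) R0
    \<le> 180 * real K * (chi_max / chi_min) * ((real K - 1 + 2 * real (card (badpairs K R0))) / gap_min) * L"
proof -
  let ?V = "real (card (badpairs K R0))"
  define Q where "Q = M / (chi_min * gap_min)"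
  have Q: "Q > 0" unfolding Q_def using M_pos chi_min_pos gap_min_pos by simp
  have "pair_sum (\<lambda>_ _. 0) (\<lambda>_ _. 0) (tracked (\<lambda>_ _. 0) R0) \<le> card (tracked (\<lambda>_ _. 0) R0) * C"
    unfolding pair_sum_def
    by (intro sum_bounded_above psi_zero_le)
       (use tracked_subset[of "\<lambda>_ _. 0" R0] in \<open>auto simp: pairs_def\<close>)
  also have "\<dots> \<le> (real K - 1) * C"
  proof -
    have "tracked (\<lambda>_ _. 0) R0 \<subseteq> adj_pair R0 ` {1..<K}" by (auto simp: tracked_def)
    then have "card (tracked (\<lambda>_ _. 0) R0) \<le> card (adj_pair R0 ` {1..<K})" by (intro card_mono) auto
    also have "\<dots> \<le> K - 1" using card_image_le[of "{1..<K}" "adj_pair R0"] by simp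
    finally have "real (card (tracked (\<lambda>_ _. 0) R0)) \<le> real K - 1" using K_ge_2 by linarith
    then show ?thesis using C_pos by (intro mult_right_mono) auto
  qed
  finally have ps: "pair_sum (\<lambda>_ _. 0) (\<lambda>_ _. 0) (tracked (\<lambda>_ _. 0) R0) \<le> (real K - 1) * C" .
  have cw: "confident_wrong \<delta> K (\<lambda>_ _. 0) (\<lambda>_ _. 0) R0 = {}" by (simp add: confident_wrong_def thr_def)
  have "M \<le> Q"
  proof -
    have "gap_min \<le> 1" using adjacent_gap[of 1] alpha_bounds(2)[of 1] alpha_bounds(1)[of "Suc 1"] K_ge_2 by simp
    then have "chi_min * gap_min \<le> 1 * 1" using chi_le_1 chi_nonneg gap_min_pos by (intro mult_mono) auto
    then show ?thesis unfolding Q_def using M_pos chi_min_pos gap_min_pos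
      by (simp add: le_divide_eq)
  qed
  moreover have C: "C = Q * (64 * L + 168)" by (simp add: C_def Q_def)
  ultimately have "2 * C + 5 * M \<le> Q * (128 * L + 341)" by (simp add: algebra_simps)
  \<comment> \<open>The left constant is \<open>2 * 168 + 5\<close>, using \<open>M <= Q\<close>;
    \<open>L >= 8 / 3\<close> absorbs it into the leading term.\<close>
  also have "\<dots> \<le> Q * (360 * L)" using Q L_ge by (intro mult_left_mono) auto
  finally have "(2 * C + 5 * M) * ?V \<le> Q * (360 * L) * ?V" by (intro mult_right_mono) auto
  moreover have "C \<le> Q * (180 * L)" unfolding C using Q L_ge by (intro mult_left_mono) auto
  then have "(real K - 1) * C \<le> (real K - 1) * (Q * (180 * L))" using K_ge_2 by (intro mult_left_mono) auto
  moreover have "M * viol_sum t R0 \<ge> 0" using M_pos viol_sum_nonneg by simp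
  ultimately have "potential t (\<lambda>_ _. 0) (\<lambda>_ _. 0) R0 \<le> (real K - 1) * (Q * (180 * L)) + Q * (360 * L) * ?V"
    using ps unfolding potential_def cw by simp
  also have "\<dots> = 180 * Q * (real K - 1 + 2 * ?V) * L" by (simp add: algebra_simps)
  also have "\<dots> = 180 * real K * (chi_max / chi_min) * ((real K - 1 + 2 * ?V) / gap_min) * L"
    by (simp add: Q_def M_def)
  finally show ?thesis .
qed

text \<open>There are at most \<open>K^2\<close> pairs, each starting with the deviation
  \<open>\<delta> * n\<close>, and \<open>\<delta> <= sqrt \<delta>\<close>.\<close>

lemma failure_init_le: "failure n (\<lambda>_ _. 0) (\<lambda>_ _. 0) \<le> sqrt \<delta> * real K ^ 3 * real n ^ 2"
proof -
  have "card pairs \<le> card ({1..K} \<times> {1..K})" using pairs_subset by (intro card_mono) auto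
  then have cp: "real (card pairs) \<le> real K * real K" by (simp flip: of_nat_mult)
  have "\<delta> = sqrt \<delta> * sqrt \<delta>" using delta by simp
  also have "\<dots> \<le> 1 * sqrt \<delta>" using delta by (intro mult_right_mono) auto
  finally have ds: "\<delta> \<le> sqrt \<delta>" by simp
  have "failure n (\<lambda>_ _. 0) (\<lambda>_ _. 0) = real (card pairs) * \<delta> * (real n * real K * real n)"
    unfolding failure_def deviation_zero by simp
  also have "\<dots> \<le> (real K * real K) * sqrt \<delta> * (real n * real K * real n)"
    using cp ds delta by (intro mult_right_mono mult_mono) auto
  also have "\<dots> = sqrt \<delta> * real K ^ 3 * real n ^ 2" by (simp add: power2_eq_square power3_eq_cube)
  finally show ?thesis .
qed

theorem regret_bound:
  assumes R0: "R0 \<in> lists_K K"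
  shows "regret PA PX K \<delta> R0 n \<le>
     180 * real K * (chi_max / chi_min) * ((real K - 1 + 2 * real (card (badpairs K R0))) / gap_min) * L
     + sqrt \<delta> * real K ^ 3 * real n ^ 2"
proof -
  have v: "valid 0 (\<lambda>_ _. 0) (\<lambda>_ _. 0) R0" using R0 by (simp add: valid_def)
  have g: "good \<delta> K (\<lambda>_ _. 0) (\<lambda>_ _. 0)" by (simp add: good_def thr_def)
  have "regret PA PX K \<delta> R0 n = regret_to_go n 0 (\<lambda>_ _. 0, \<lambda>_ _. 0, R0)"
    unfolding regret_def Max_rew using sum_displayed_regret[OF R0, of 0 n] by simp
  also have "\<dots> \<le> potential (Suc 0) (\<lambda>_ _. 0) (\<lambda>_ _. 0) R0 + failure n (\<lambda>_ _. 0) (\<lambda>_ _. 0)"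
    using regret_to_go_le_potential[OF v, of n n] g by simp
  also have "\<dots> \<le> 180 * real K * (chi_max / chi_min) * ((real K - 1 + 2 * real (card (badpairs K R0))) / gap_min) * L
     + sqrt \<delta> * real K ^ 3 * real n ^ 2"
    by (intro add_mono potential_init_le[OF R0] failure_init_le)
  finally show ?thesis .
qed

end

theorem theorem1:
  fixes PA :: "(nat \<Rightarrow> bool) pmf" and PX :: "(rlist \<Rightarrow> nat \<Rightarrow> bool) pmf"
    and K n :: nat and \<delta> :: real and R0 :: rlist
  defines "alpha \<equiv> attr PA" and "chi \<equiv> exam PX"
  assumes A1: "\<forall>R \<in> lists_K K. rew K alpha chi R \<le> rew K alpha chi id"
    and A2: "\<forall>R \<in> lists_K K. \<forall>R' \<in> lists_K K. \<forall>k \<in> {1..K}.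
               R ` {1..<k} = R' ` {1..<k} \<longrightarrow> chi R k = chi R' k"
    and A3: "\<forall>R \<in> lists_K K. \<forall>k l. 1 \<le> k \<and> k < l \<and> l \<le> K \<longrightarrow> chi R k \<ge> chi R l"
    and A4: "\<forall>R \<in> lists_K K. \<forall>R' \<in> lists_K K. \<forall>k l. 1 \<le> k \<and> k < l \<and> l \<le> K \<and>
               R' = swap_pos R k l \<longrightarrow> (alpha (R k) \<le> alpha (R l) \<longleftrightarrow> chi R l \<ge> chi R' l)"
    and A5: "\<forall>R \<in> lists_K K. \<forall>k \<in> {1..K}. chi R k \<ge> chi id k"
    and decr: "\<forall>k \<in> {1..<K}. alpha k > alpha (k+1)"
    and pos: "alpha K > 0"
    and chi_min_pos: "chi id K > 0"
    and delta: "0 < \<delta>" "\<delta> < 1"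
    and R0: "R0 \<in> lists_K K"
  shows "regret PA PX K \<delta> R0 n \<le>
     180 * real K * (chi id 1 / chi id K)
       * ((real K - 1 + 2 * real (card (badpairs K R0)))
           / Min ((\<lambda>k. alpha k - alpha (k+1)) ` {1..<K}))
       * ln (1/\<delta>)
     + sqrt \<delta> * real K ^ 3 * real n ^ 2"
proof (cases "2 \<le> K")
  case False
  then consider "K = 0" | "K = 1" by linarith
  then have lists: "lists_K K = {id}"
    by cases (auto simp: lists_K_def permutes_sing)
  have "regret PA PX K \<delta> R0 n \<le> real n * 0"
    by (rule regret_le_const[OF R0]) (simp add: lists)
  \<comment> \<open>For \<open>K <= 1\<close> the minimum is taken over the empty set and has no
    useful value, but this factor makes the first term of the bound vanish.\<close>
  moreover have "real K * (real K - 1 + 2 * real (card (badpairs K R0))) = 0"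
  proof -
    have "badpairs K R0 = {}" using False by (auto simp: badpairs_def)
    then show ?thesis using False by (cases K) auto
  qed
  moreover have "sqrt \<delta> * real K ^ 3 * real n ^ 2 \<ge> 0" using delta by simp
  ultimately show ?thesis by auto
next
  case K2: True
  show ?thesis
  proof (cases "\<delta> < 1 / 16")
    case True
    interpret bubble_rank PA PX K \<delta>
      using A1 A2 A3 A4 A5 decr pos chi_min_pos K2 delta(1) True
      unfolding alpha_def chi_def by unfold_locales
    show ?thesis
      using regret_bound[OF R0, of n] unfolding gap_min_def L_def alpha_def chi_def .
  next
    case False
    have "regret PA PX K \<delta> R0 n \<le> real n * real K" by (rule regret_le_trivial[OF R0])
    also have "\<dots> \<le> sqrt \<delta> * real K ^ 3 * real n ^ 2"
    proof (cases "n = 0")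
      case n: False
      \<comment> \<open>Here \<open>sqrt \<delta> >= 1 / 4\<close> is compensated by
        \<open>K^3 >= 4 * K\<close>, so the second term alone exceeds the trivial bound.\<close>
      have "sqrt (1 / 16) \<le> sqrt \<delta>" using False by simp
      then have "1 / 4 \<le> sqrt \<delta>" by (simp add: real_sqrt_divide)
      moreover have "4 * real K \<le> real K ^ 3"
      proof -
        have "2 * 2 * real K \<le> real K * real K * real K" using K2 by (intro mult_mono) auto
        then show ?thesis by (simp add: power3_eq_cube)
      qed
      ultimately have "1 / 4 * (4 * real K) \<le> sqrt \<delta> * real K ^ 3"
        using delta by (intro mult_mono) auto
      moreover have "real n \<le> real n ^ 2" using n by (simp add: power2_eq_square)
      ultimately have "real K * real n \<le> sqrt \<delta> * real K ^ 3 * real n ^ 2"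
        using delta by (intro mult_mono) auto
      then show ?thesis by (simp add: mult.commute)
    qed simp
    also have "\<dots> \<le> 180 * real K * (chi id 1 / chi id K)
       * ((real K - 1 + 2 * real (card (badpairs K R0)))
           / Min ((\<lambda>k. alpha k - alpha (k+1)) ` {1..<K}))
       * ln (1/\<delta>) + sqrt \<delta> * real K ^ 3 * real n ^ 2"
    proof -
      have min: "Min ((\<lambda>k. alpha k - alpha (k+1)) ` {1..<K}) > 0"
        using decr K2 by (subst Min_gr_iff) auto
      have "chi id 1 \<ge> 0" by (simp add: chi_def exam_def)
      moreover have "ln (1 / \<delta>) \<ge> 0" using delta by simp
      ultimately have "0 \<le> 180 * real K * (chi id 1 / chi id K)
       * ((real K - 1 + 2 * real (card (badpairs K R0)))
           / Min ((\<lambda>k. alpha k - alpha (k+1)) ` {1..<K})) * ln (1/\<delta>)"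
        using chi_min_pos K2 less_imp_le[OF min]
        by (intro mult_nonneg_nonneg divide_nonneg_nonneg) auto
      then show ?thesis by simp
    qed
    finally show ?thesis .
  qed
qed

end
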